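(* Let $E\in\mathbb{C}^{n\times n}$ be Hermitian, $F\in\mathbb{C}^{m\times n}$, $G\in\mathbb{C}^{m\times m}$, $q\in\mathbb{C}^n$, $r\in\mathbb{C}^m$, with $\begin{bmatrix}E&F^*\\ F&G\end{bmatrix}$ nonsingular, let $\alpha_1,\alpha_2,\alpha_3,\beta_1,\beta_2>0$, and let $\widehat{x}=[\widehat u^{T},\widehat p^{T}]^{T}$ with $\widehat u\in\mathbb{C}^n$, $\widehat p\in\mathbb{C}^m$ be a computed (approximate) solution of $\begin{bmatrix}E&F^*\\ F&G\end{bmatrix}\begin{bmatrix}u\\ p\end{bmatrix}=\begin{bmatrix}q\\ r\end{bmatrix}$. Put $Q=q-E\widehat u-F^*\widehat p$, $R=r-F\widehat u-G\widehat p$, $\mathcal{I}_1=[-\beta_1^{-1}I_{2n}\;\;0_{2n\times 2m}]$, $\mathcal{I}_2=[0_{2m\times 2n}\;\;-\beta_2^{-1}I_{2m}]$, $\mathbf{X}_1=[\widehat{\mathbf{X}}_1\;\;0_{2n\times 2m^2}]$, $\mathbf{X}_2=[0_{2m\times n^2}\;\;\widehat{\mathbf{X}}_2]$, where $$\widehat{\mathbf{X}}_1=\begin{bmatrix}\alpha_1^{-1}(\Re(\widehat u)^T\otimes I_n)N_1&-\alpha_1^{-1}(\Im(\widehat u)^T\otimes I_n)N_2&\alpha_2^{-1}(I_n\otimes\Re(\widehat p)^T)\Sigma_F&\alpha_2^{-1}(I_n\otimes\Im(\widehat p)^T)\Sigma_F\\ \alpha_1^{-1}(\Im(\widehat u)^T\otimes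 I_n)N_1&\alpha_1^{-1}(\Re(\widehat u)^T\otimes I_n)N_2&\alpha_2^{-1}(I_n\otimes\Im(\widehat p)^T)\Sigma_F&-\alpha_2^{-1}(I_n\otimes\Re(\widehat p)^T)\Sigma_F\end{bmatrix},$$ $$\widehat{\mathbf{X}}_2=\begin{bmatrix}\alpha_2^{-1}(\Re(\widehat u)^T\otimes I_m)\Sigma_F&-\alpha_2^{-1}(\Im(\widehat u)^T\otimes I_m)\Sigma_F&\alpha_3^{-1}(\Re(\widehat p)^T\otimes I_m)\Sigma_G&-\alpha_3^{-1}(\Im(\widehat p)^T\otimes I_m)\Sigma_G\\ \alpha_2^{-1}(\Im(\widehat u)^T\otimes I_m)\Sigma_F&\alpha_2^{-1}(\Re(\widehat u)^T\otimes I_m)\Sigma_F&\alpha_3^{-1}(\Im(\widehat p)^T\otimes I_m)\Sigma_G&\alpha_3^{-1}(\Re(\widehat p)^T\otimes I_m)\Sigma_G\end{bmatrix}.$$ Then the sparsity-preserving structured backward error is $$\xi^{\mathcal{G}_1}_{\rm sps}(\widehat u,\widehat p)=\left\|\begin{bmatrix}\mathbf{X}_1&\mathcal{I}_1\\ \mathbf{X}_2&\mathcal{I}_2\end{bmatrix}^T\left(\begin{bmatrix}\mathbf{X}_1&\mathcal{I}_1\\ \mathbf{X}_2&\mathcal{I}_2\end{bmatrix}\begin{bmatrix}\mathbf{X}_1&\mathcal{I}_1\\ \mathbf{X}_2&\mathcal{I}_2\end{bmatrix}^T\right)^{-1}\begin{bmatrix}\Re(Q)\\ \Im(Q)\\ \Re(R)\\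 \Im(R)\end{bmatrix}\right\|_2 .$$
   Context: Notation. $\Re,\Im$ are entrywise real and imaginary parts, $T$ is transpose, $*$ is conjugate transpose, $\otimes$ is the Kronecker product, $\odot$ the entrywise product, and $\mathrm{vec}$ stacks columns. For a matrix $X$, $\Theta_X$ is the matrix of the same size with entry $1$ where $X$ has a nonzero entry and $0$ where $X$ has a zero entry; $\Sigma_X=\mathrm{diag}(\mathrm{vec}(\Theta_X))$. For a real symmetric $k\times k$ matrix $Z$, $\mathrm{vec}_S(Z)\in\mathbb{R}^{k(k+1)/2}$ stacks the columns of the lower triangle including the diagonal: $(z_{11},\dots,z_{k1},z_{22},\dots,z_{k2},\dots,z_{kk})^T$. For a real skew-symmetric $Z$, $\mathrm{vec}_{SK}(Z)\in\mathbb{R}^{k(k-1)/2}$ stacks the columns of the strict lower triangle: $(z_{21},\dots,z_{k1},z_{32},\dots,z_{k2},\dots,z_{k(k-1)})^T$. $\mathcal{J}^k_S\in\mathbb{R}^{k^2\times k(k+1)/2}$ and $\mathcal{J}^k_{SK}\in\mathbb{R}^{k^2\times k(k-1)/2}$ are the matrices with $\mathrm{vec}(Z)=\mathcal{J}^k_S\mathrm{vec}_S(Z)$ for all real symmetric $Z$ and $\mathrm{vec}(Z)=\mathcal{J}^k_{SK}\mathrm{vec}_{SK}(Z)$ for all real skew-symmetric $Z$. For Hermitian $X$ of size $k$, $\Phi_X=\mathrm{diag}(\mathrm{vec}_S(\Theta_X))$ and $\Psi_X$ is the diagonal matrix whose diagonal is $(\Theta_X(1,2),\dots,\Theta_X(1,k),\Theta_X(2,3),\dots,\Theta_X(2,k),\dots,\Theta_X(k-1,k))$.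 $\mathfrak{D}_{S,k}$ is the diagonal matrix of size $k(k+1)/2$ with entry $1$ at the positions that $\mathrm{vec}_S$ assigns to diagonal entries, i.e. $j=\frac{(2k-(i-2))(i-1)}{2}+1$, $i=1,\dots,k$, and $\sqrt2$ at all other positions; $\mathfrak{D}_{SK,k}=\sqrt2\,I_{k(k-1)/2}$. Set $N_1=\mathcal{J}^n_S\Phi_E\mathfrak{D}_{S,n}^{-1}$, $N_2=\mathcal{J}^n_{SK}\Psi_E\mathfrak{D}_{SK,n}^{-1}$. Structured backward error. $\mathcal{G}_1$ is the set of tuples $(\Delta E,\Delta F,\Delta G,\Delta q,\Delta r)$ with $\Delta E\in\mathbb{C}^{n\times n}$ Hermitian, $\Delta F\in\mathbb{C}^{m\times n}$, $\Delta G\in\mathbb{C}^{m\times m}$, $\Delta q\in\mathbb{C}^n$, $\Delta r\in\mathbb{C}^m$ such that $$\begin{bmatrix}E+\Delta E&(F+\Delta F)^*\\ F+\Delta F&G+\Delta G\end{bmatrix}\begin{bmatrix}\widehat u\\ \widehat p\end{bmatrix}=\begin{bmatrix}q+\Delta q\\ r+\Delta r\end{bmatrix}.$$ Let $\zeta^{\sigma_1}(\Delta E,\Delta F,\Delta G,\Delta q,\Delta r)=\sqrt{\alpha_1^2\|\Delta E\|_F^2+\alpha_2^2\|\Delta F\|_F^2+\alpha_3^2\|\Delta G\|_F^2+\beta_1^2\|\Delta q\|_2^2+\beta_2^2\|\Delta r\|_2^2}$ ($\|\cdot\|_F$ the Frobenius norm). The sparsity-preserving structured backward error $\xi^{\mathcal{G}_1}_{\rm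 sps}(\widehat u,\widehat p)$ is the minimum of $\zeta^{\sigma_1}(\Delta E\odot\Theta_E,\Delta F\odot\Theta_F,\Delta G\odot\Theta_G,\Delta q,\Delta r)$ over all perturbations with $(\Delta E\odot\Theta_E,\Delta F\odot\Theta_F,\Delta G\odot\Theta_G,\Delta q,\Delta r)\in\mathcal{G}_1$. *)

theory Defs
  imports
    "Jordan_Normal_Form.Schur_Decomposition"
    "Jordan_Normal_Form.Gauss_Jordan_Elimination"
begin

text \<open>Indices are 0-based throughout: entry (i, j) of a matrix in the usual mathematical
  notation is the entry (i - 1, j - 1) here.\<close>

definition append_cols :: "'a :: zero mat \<Rightarrow> 'a mat \<Rightarrow> 'a mat" (infixr \<open>@\<^sub>c\<close> 67) where
  "A @\<^sub>c B = four_block_mat A B (0\<^sub>m 0 (dim_col A)) (0\<^sub>m 0 (dim_col B))"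

definition row_mat :: "'a vec \<Rightarrow> 'a mat" where
  "row_mat v = mat_of_rows (dim_vec v) [v]"

definition kron :: "'a :: times mat \<Rightarrow> 'a mat \<Rightarrow> 'a mat" (infixl \<open>\<otimes>\<^sub>k\<close> 75) where
  "A \<otimes>\<^sub>k B = mat (dim_row A * dim_row B) (dim_col A * dim_col B)
     (\<lambda>(i, j). A $$ (i div dim_row B, j div dim_col B) * B $$ (i mod dim_row B, j mod dim_col B))"

definition hadamard :: "'a :: times mat \<Rightarrow> 'a mat \<Rightarrow> 'a mat" (infixl \<open>\<odot>\<^sub>m\<close> 75) where
  "A \<odot>\<^sub>m B = mat (dim_row A) (dim_col A) (\<lambda>ij. A $$ ij * B $$ ij)"

text \<open>The true inverse for an invertible matrix, unspecified otherwise.\<close>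

definition mat_inv :: "'a :: field mat \<Rightarrow> 'a mat" where
  "mat_inv A = the (mat_inverse A)"

definition vec_norm2 :: "'a :: real_normed_vector vec \<Rightarrow> real" where
  "vec_norm2 v = sqrt (\<Sum>i<dim_vec v. (norm (v $ i))\<^sup>2)"

definition frob_norm :: "'a :: real_normed_vector mat \<Rightarrow> real" where
  "frob_norm A = sqrt (\<Sum>i<dim_row A. \<Sum>j<dim_col A. (norm (A $$ (i, j)))\<^sup>2)"

definition hermitian_mat :: "complex mat \<Rightarrow> bool" where
  "hermitian_mat A \<longleftrightarrow> square_mat A \<and> mat_adjoint A = A"

definition diag_of :: "'a :: zero vec \<Rightarrow> 'a mat" where
  "diag_of v = mat_diag (dim_vec v) (\<lambda>i. v $ i)"


section \<open>Vectorizations\<close>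

definition vec_idx :: "nat \<Rightarrow> nat \<Rightarrow> (nat \<times> nat) list" where
  "vec_idx a b = [(i, j). j \<leftarrow> [0..<b], i \<leftarrow> [0..<a]]"

definition vecS_idx :: "nat \<Rightarrow> (nat \<times> nat) list" where
  "vecS_idx k = [(i, j). j \<leftarrow> [0..<k], i \<leftarrow> [j..<k]]"

definition vecSK_idx :: "nat \<Rightarrow> (nat \<times> nat) list" where
  "vecSK_idx k = [(i, j). j \<leftarrow> [0..<k], i \<leftarrow> [Suc j..<k]]"

definition entries_at :: "(nat \<times> nat) list \<Rightarrow> 'a mat \<Rightarrow> 'a vec" where
  "entries_at ps X = vec_of_list (map (\<lambda>ij. X $$ ij) ps)"

definition vec_mat :: "'a mat \<Rightarrow> 'a vec" where
  "vec_mat X = entries_at (vec_idx (dim_row X) (dim_col X)) X"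

definition vecS :: "'a mat \<Rightarrow> 'a vec" where
  "vecS X = entries_at (vecS_idx (dim_row X)) X"

definition vecSK :: "'a mat \<Rightarrow> 'a vec" where
  "vecSK X = entries_at (vecSK_idx (dim_row X)) X"

definition sym_mats :: "nat \<Rightarrow> real mat set" where
  "sym_mats k = {Z \<in> carrier_mat k k. Z\<^sup>T = Z}"

definition skew_mats :: "nat \<Rightarrow> real mat set" where
  "skew_mats k = {Z \<in> carrier_mat k k. Z\<^sup>T = - Z}"

text \<open>Both matrices exist and are unique, see \<open>J_S_spec\<close> and \<open>J_SK_spec\<close> below.\<close>

definition J_S :: "nat \<Rightarrow> real mat" where
  "J_S k = (THE J. J \<in> carrier_mat (k\<^sup>2) (k * (k + 1) div 2) \<and>
     (\<forall>Z \<in> sym_mats k. vec_mat Z = J *\<^sub>v vecS Z))"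

definition J_SK :: "nat \<Rightarrow> real mat" where
  "J_SK k = (THE J. J \<in> carrier_mat (k\<^sup>2) (k * (k - 1) div 2) \<and>
     (\<forall>Z \<in> skew_mats k. vec_mat Z = J *\<^sub>v vecSK Z))"


section \<open>Sparsity patterns and weights\<close>

definition Theta :: "'a :: zero mat \<Rightarrow> 'b :: zero_neq_one mat" where
  "Theta X = map_mat (\<lambda>x. if x = 0 then 0 else 1) X"

definition Sigma_mat :: "complex mat \<Rightarrow> real mat" where
  "Sigma_mat X = diag_of (vec_mat (Theta X))"

definition Phi_mat :: "complex mat \<Rightarrow> real mat" where
  "Phi_mat X = diag_of (vecS (Theta X))"

text \<open>The diagonal runs row by row through the strict upper triangle.\<close>

definition Psi_mat :: "complex mat \<Rightarrow> real mat" where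
  "Psi_mat X = diag_of (entries_at [(i, j). i \<leftarrow> [0..<dim_row X], j \<leftarrow> [Suc i..<dim_row X]] (Theta X))"

text \<open>The 1-based position is \<open>Suc p\<close>.  For \<open>i \<in> {1..k}\<close>, \<open>2 * k + 2 - i\<close> is
  \<open>2 * k - (i - 2)\<close> without truncated subtraction.\<close>

definition D_S :: "nat \<Rightarrow> real mat" where
  "D_S k = mat_diag (k * (k + 1) div 2)
     (\<lambda>p. if \<exists>i\<in>{1..k}. Suc p = (2 * k + 2 - i) * (i - 1) div 2 + 1 then 1 else sqrt 2)"

definition D_SK :: "nat \<Rightarrow> real mat" where
  "D_SK k = sqrt 2 \<cdot>\<^sub>m 1\<^sub>m (k * (k - 1) div 2)"

definition N1 :: "complex mat \<Rightarrow> real mat" where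
  "N1 E = J_S (dim_row E) * Phi_mat E * mat_inv (D_S (dim_row E))"

definition N2 :: "complex mat \<Rightarrow> real mat" where
  "N2 E = J_SK (dim_row E) * Psi_mat E * mat_inv (D_SK (dim_row E))"


section \<open>Structured backward error\<close>

type_synonym pert = "complex mat \<times> complex mat \<times> complex mat \<times> complex vec \<times> complex vec"

definition saddle :: "complex mat \<Rightarrow> complex mat \<Rightarrow> complex mat \<Rightarrow> complex mat" where
  "saddle E F G = four_block_mat E (mat_adjoint F) F G"

definition perts :: "nat \<Rightarrow> nat \<Rightarrow> pert set" where
  "perts n m = carrier_mat n n \<times> carrier_mat m n \<times> carrier_mat m m \<times> carrier_vec n \<times> carrier_vec m"

text \<open>The sizes of the perturbations are those of the right-hand sides \<open>q\<close> and \<open>r\<close>;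
  \<open>u\<close> and \<open>p\<close> are the two blocks of the approximate solution.\<close>

definition G1 :: "complex mat \<Rightarrow> complex mat \<Rightarrow> complex mat \<Rightarrow> complex vec \<Rightarrow> complex vec
    \<Rightarrow> complex vec \<Rightarrow> complex vec \<Rightarrow> pert set" where
  "G1 E F G q r u p = {(dE, dF, dG, dq, dr) \<in> perts (dim_vec q) (dim_vec r).
     hermitian_mat dE \<and>
     saddle (E + dE) (F + dF) (G + dG) *\<^sub>v (u @\<^sub>v p) = (q + dq) @\<^sub>v (r + dr)}"

fun zeta :: "real \<Rightarrow> real \<Rightarrow> real \<Rightarrow> real \<Rightarrow> real \<Rightarrow> pert \<Rightarrow> real" where
  "zeta \<alpha>1 \<alpha>2 \<alpha>3 \<beta>1 \<beta>2 (dE, dF, dG, dq, dr) =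
     sqrt (\<alpha>1\<^sup>2 * (frob_norm dE)\<^sup>2 + \<alpha>2\<^sup>2 * (frob_norm dF)\<^sup>2 + \<alpha>3\<^sup>2 * (frob_norm dG)\<^sup>2
       + \<beta>1\<^sup>2 * (vec_norm2 dq)\<^sup>2 + \<beta>2\<^sup>2 * (vec_norm2 dr)\<^sup>2)"

fun mask :: "complex mat \<Rightarrow> complex mat \<Rightarrow> complex mat \<Rightarrow> pert \<Rightarrow> pert" where
  "mask E F G (dE, dF, dG, dq, dr) =
     (dE \<odot>\<^sub>m Theta E, dF \<odot>\<^sub>m Theta F, dG \<odot>\<^sub>m Theta G, dq, dr)"

definition sps_values :: "real \<Rightarrow> real \<Rightarrow> real \<Rightarrow> real \<Rightarrow> real \<Rightarrow> complex mat \<Rightarrow> complex mat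
    \<Rightarrow> complex mat \<Rightarrow> complex vec \<Rightarrow> complex vec \<Rightarrow> complex vec \<Rightarrow> complex vec \<Rightarrow> real set" where
  "sps_values \<alpha>1 \<alpha>2 \<alpha>3 \<beta>1 \<beta>2 E F G q r u p =
     {zeta \<alpha>1 \<alpha>2 \<alpha>3 \<beta>1 \<beta>2 (mask E F G t) | t.
        t \<in> perts (dim_vec q) (dim_vec r) \<and> mask E F G t \<in> G1 E F G q r u p}"

text \<open>The least element of the set of values, that is, an attained minimum; unspecified if
  there is no least element.\<close>

definition xi_sps :: "real \<Rightarrow> real \<Rightarrow> real \<Rightarrow> real \<Rightarrow> real \<Rightarrow> complex mat \<Rightarrow> complex mat
    \<Rightarrow> complex mat \<Rightarrow> complex vec \<Rightarrow> complex vec \<Rightarrow> complex vec \<Rightarrow> complex vec \<Rightarrow> real" where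
  "xi_sps \<alpha>1 \<alpha>2 \<alpha>3 \<beta>1 \<beta>2 E F G q r u p =
     (LEAST x. x \<in> sps_values \<alpha>1 \<alpha>2 \<alpha>3 \<beta>1 \<beta>2 E F G q r u p)"


section \<open>The coefficient matrix of the closed formula\<close>

definition X1_hat :: "nat \<Rightarrow> real \<Rightarrow> real \<Rightarrow> complex mat \<Rightarrow> complex mat
    \<Rightarrow> complex vec \<Rightarrow> complex vec \<Rightarrow> real mat" where
  "X1_hat n \<alpha>1 \<alpha>2 E F u p =
    (let ur = row_mat (map_vec Re u); ui = row_mat (map_vec Im u);
         pr = row_mat (map_vec Re p); pi = row_mat (map_vec Im p) in
       (inverse \<alpha>1 \<cdot>\<^sub>m ((ur \<otimes>\<^sub>k 1\<^sub>m n) * N1 E)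
        @\<^sub>c - (inverse \<alpha>1 \<cdot>\<^sub>m ((ui \<otimes>\<^sub>k 1\<^sub>m n) * N2 E))
        @\<^sub>c inverse \<alpha>2 \<cdot>\<^sub>m ((1\<^sub>m n \<otimes>\<^sub>k pr) * Sigma_mat F)
        @\<^sub>c inverse \<alpha>2 \<cdot>\<^sub>m ((1\<^sub>m n \<otimes>\<^sub>k pi) * Sigma_mat F))
       @\<^sub>r
       (inverse \<alpha>1 \<cdot>\<^sub>m ((ui \<otimes>\<^sub>k 1\<^sub>m n) * N1 E)
        @\<^sub>c inverse \<alpha>1 \<cdot>\<^sub>m ((ur \<otimes>\<^sub>k 1\<^sub>m n) * N2 E)
        @\<^sub>c inverse \<alpha>2 \<cdot>\<^sub>m ((1\<^sub>m n \<otimes>\<^sub>k pi) * Sigma_mat F)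
        @\<^sub>c - (inverse \<alpha>2 \<cdot>\<^sub>m ((1\<^sub>m n \<otimes>\<^sub>k pr) * Sigma_mat F))))"

definition X2_hat :: "nat \<Rightarrow> real \<Rightarrow> real \<Rightarrow> complex mat \<Rightarrow> complex mat
    \<Rightarrow> complex vec \<Rightarrow> complex vec \<Rightarrow> real mat" where
  "X2_hat m \<alpha>2 \<alpha>3 F G u p =
    (let ur = row_mat (map_vec Re u); ui = row_mat (map_vec Im u);
         pr = row_mat (map_vec Re p); pi = row_mat (map_vec Im p) in
       (inverse \<alpha>2 \<cdot>\<^sub>m ((ur \<otimes>\<^sub>k 1\<^sub>m m) * Sigma_mat F)
        @\<^sub>c - (inverse \<alpha>2 \<cdot>\<^sub>m ((ui \<otimes>\<^sub>k 1\<^sub>m m) * Sigma_mat F))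
        @\<^sub>c inverse \<alpha>3 \<cdot>\<^sub>m ((pr \<otimes>\<^sub>k 1\<^sub>m m) * Sigma_mat G)
        @\<^sub>c - (inverse \<alpha>3 \<cdot>\<^sub>m ((pi \<otimes>\<^sub>k 1\<^sub>m m) * Sigma_mat G)))
       @\<^sub>r
       (inverse \<alpha>2 \<cdot>\<^sub>m ((ui \<otimes>\<^sub>k 1\<^sub>m m) * Sigma_mat F)
        @\<^sub>c inverse \<alpha>2 \<cdot>\<^sub>m ((ur \<otimes>\<^sub>k 1\<^sub>m m) * Sigma_mat F)
        @\<^sub>c inverse \<alpha>3 \<cdot>\<^sub>m ((pi \<otimes>\<^sub>k 1\<^sub>m m) * Sigma_mat G)
        @\<^sub>c inverse \<alpha>3 \<cdot>\<^sub>m ((pr \<otimes>\<^sub>k 1\<^sub>m m) * Sigma_mat G)))"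


section \<open>Existence and uniqueness of the duplication matrices\<close>

lemma entries_at_simps [simp]:
  "dim_vec (entries_at ps X) = length ps"
  "t < length ps \<Longrightarrow> entries_at ps X $ t = X $$ (ps ! t)"
  by (auto simp: entries_at_def vec_of_list_index)

lemma set_idx:
  "set (vec_idx a b) = {..<a} \<times> {..<b}"
  "set (vecS_idx k) = {(i, j). j \<le> i \<and> i < k}"
  "set (vecSK_idx k) = {(i, j). j < i \<and> i < k}"
  by (force simp: vec_idx_def vecS_idx_def vecSK_idx_def)+

lemma distinct_pairs:
  "distinct (concat (map (\<lambda>j. map (\<lambda>i. (i, j)) [f j..<k]) js))" if "distinct js"
  using that by (induction js) (auto simp: distinct_map inj_on_def)

lemma distinct_idx: "distinct (vecS_idx k)" "distinct (vecSK_idx k)"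
  using distinct_pairs[of "[0..<k]" "\<lambda>j. j" k] distinct_pairs[of "[0..<k]" Suc k]
  by (simp_all add: vecS_idx_def vecSK_idx_def)

lemma length_idx:
  "length (vec_idx a b) = a * b"
  "length (vecS_idx k) = k * (k + 1) div 2"
  "length (vecSK_idx k) = k * (k - 1) div 2"
proof -
  show "length (vec_idx a b) = a * b"
    by (simp add: vec_idx_def length_concat comp_def sum_list_triv)
  have "(\<Sum>j<k. k - j) = k * (k + 1) div 2"
  proof (induction k)
    case (Suc k)
    have "(\<Sum>j<Suc k. Suc k - j) = Suc k + (\<Sum>j<k. k - j)"
      by (simp add: sum.lessThan_Suc_shift del: sum.lessThan_Suc)
    with Suc show ?case by simp
  qed simp
  then show "length (vecS_idx k) = k * (k + 1) div 2"
    by (simp add: vecS_idx_def length_concat comp_def interv_sum_list_conv_sum_set_nat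
        atLeast0LessThan)
  have "(\<Sum>j<k. k - Suc j) = k * (k - 1) div 2"
    using sum.nat_diff_reindex[of "\<lambda>i. i" k] Sum_Ico_nat[of 0 k]
    by (simp add: atLeast0LessThan)
  then show "length (vecSK_idx k) = k * (k - 1) div 2"
    by (simp add: vecSK_idx_def length_concat comp_def interv_sum_list_conv_sum_set_nat
        atLeast0LessThan)
qed

lemma mat_unit_vec_col:
  "A *\<^sub>v unit_vec n t = col A t" if "A \<in> carrier_mat k n" "t < n" for A :: "real mat"
  using that by (intro eq_vecI) auto

lemma ex1_duplication:
  fixes S :: "real mat set"
  assumes S: "S \<subseteq> carrier_mat k k" and dist: "distinct ps"
    and surj: "\<And>f. \<exists>Z \<in> S. \<forall>ij \<in> set ps. Z $$ ij = f ij"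
    and rep: "\<And>Z ij. Z \<in> S \<Longrightarrow> ij \<in> {..<k} \<times> {..<k} \<Longrightarrow>
      Z $$ ij = (if x ij \<in> set ps then c ij * Z $$ x ij else 0)"
  shows "\<exists>!J. J \<in> carrier_mat (k\<^sup>2) (length ps) \<and>
    (\<forall>Z \<in> S. vec_mat Z = J *\<^sub>v entries_at ps Z)"
proof (rule ex_ex1I)
  let ?N = "length ps"
  define J where "J = mat (k\<^sup>2) ?N
    (\<lambda>(s, t). if ps ! t = x (vec_idx k k ! s) then c (vec_idx k k ! s) else 0)"
  have "vec_mat Z = J *\<^sub>v entries_at ps Z" if Z: "Z \<in> S" for Z
  proof (rule eq_vecI)
    have dimZ: "dim_row Z = k" "dim_col Z = k"
      using Z S by auto
    show "dim_vec (vec_mat Z) = dim_vec (J *\<^sub>v entries_at ps Z)"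
      by (simp add: vec_mat_def dimZ length_idx J_def power2_eq_square)
    fix s assume "s < dim_vec (J *\<^sub>v entries_at ps Z)"
    then have s: "s < k\<^sup>2" by (simp add: J_def)
    define ij where "ij = vec_idx k k ! s"
    have len: "s < length (vec_idx k k)"
      using s by (simp add: length_idx power2_eq_square)
    have ij: "ij \<in> {..<k} \<times> {..<k}"
      using nth_mem[OF len] by (simp add: ij_def set_idx)
    have "(J *\<^sub>v entries_at ps Z) $ s
        = (\<Sum>t<?N. (if ps ! t = x ij then c ij else 0) * Z $$ (ps ! t))"
      unfolding ij_def using s by (simp add: J_def scalar_prod_def atLeast0LessThan)
    also have "\<dots> = (\<Sum>y\<in>set ps. (if y = x ij then c ij else 0) * Z $$ y)"
      using sum.reindex_bij_betw[OF bij_betw_nth[OF dist refl refl],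
          of "\<lambda>y. (if y = x ij then c ij else 0) * Z $$ y"] by simp
    also have "\<dots> = (\<Sum>y\<in>set ps. if y = x ij then c ij * Z $$ y else 0)"
      by (rule sum.cong) auto
    also have "\<dots> = Z $$ ij"
      using rep[OF Z ij] by simp
    also have "\<dots> = vec_mat Z $ s"
      using len by (simp add: vec_mat_def dimZ ij_def)
    finally show "vec_mat Z $ s = (J *\<^sub>v entries_at ps Z) $ s" ..
  qed
  then show "\<exists>J. J \<in> carrier_mat (k\<^sup>2) ?N \<and> (\<forall>Z \<in> S. vec_mat Z = J *\<^sub>v entries_at ps Z)"
    by (intro exI[of _ J]) (simp add: J_def)
next
  let ?N = "length ps"
  fix J J' :: "real mat"
  assume J: "J \<in> carrier_mat (k\<^sup>2) ?N \<and> (\<forall>Z \<in> S. vec_mat Z = J *\<^sub>v entries_at ps Z)"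
    and J': "J' \<in> carrier_mat (k\<^sup>2) ?N \<and> (\<forall>Z \<in> S. vec_mat Z = J' *\<^sub>v entries_at ps Z)"
  have col: "col J t = col J' t" if t: "t < ?N" for t
  proof -
    obtain Z where Z: "Z \<in> S" "\<forall>ij \<in> set ps. Z $$ ij = (if ij = ps ! t then 1 else 0)"
      using surj[of "\<lambda>ij. if ij = ps ! t then 1 else 0"] by blast
    have "entries_at ps Z = unit_vec ?N t"
      using Z(2) dist t by (intro eq_vecI) (auto simp: nth_eq_iff_index_eq)
    then have "J *\<^sub>v unit_vec ?N t = J' *\<^sub>v unit_vec ?N t"
      using J J' Z(1) by metis
    then show ?thesis
      using J J' t by (metis mat_unit_vec_col)
  qed
  show "J = J'"
  proof (rule eq_matI)
    fix s t assume "s < dim_row J'" "t < dim_col J'"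
    with col[of t] J J' show "J $$ (s, t) = J' $$ (s, t)"
      by (metis carrier_matD index_col)
  qed (use J J' in auto)
qed

lemma J_S_spec:
  "J_S k \<in> carrier_mat (k\<^sup>2) (k * (k + 1) div 2)"
  "Z \<in> sym_mats k \<Longrightarrow> vec_mat Z = J_S k *\<^sub>v vecS Z"
proof -
  have "\<exists>!J. J \<in> carrier_mat (k\<^sup>2) (length (vecS_idx k)) \<and>
    (\<forall>Z \<in> sym_mats k. vec_mat Z = J *\<^sub>v entries_at (vecS_idx k) Z)"
  proof (rule ex1_duplication[where c = "\<lambda>_. 1" and x = "\<lambda>(i, j). (max i j, min i j)"])
    fix f :: "nat \<times> nat \<Rightarrow> real"
    let ?Z = "mat k k (\<lambda>(i, j). f (max i j, min i j))"
    have "?Z \<in> sym_mats k"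
      by (auto simp: sym_mats_def max.commute min.commute)
    moreover have "\<forall>ij \<in> set (vecS_idx k). ?Z $$ ij = f ij"
      by (auto simp: set_idx max_def min_def)
    ultimately show "\<exists>Z \<in> sym_mats k. \<forall>ij \<in> set (vecS_idx k). Z $$ ij = f ij" by blast
  next
    fix Z ij assume "Z \<in> sym_mats k" and ij: "ij \<in> {..<k} \<times> {..<k}"
    then have Z: "Z \<in> carrier_mat k k" "Z\<^sup>T = Z" by (auto simp: sym_mats_def)
    obtain i j where [simp]: "ij = (i, j)" by (cases ij)
    have "Z $$ (i, j) = Z $$ (j, i)"
      using ij Z(1) arg_cong[OF Z(2), of "\<lambda>A. A $$ (i, j)"] by auto
    then show "Z $$ ij = (if (case ij of (i, j) \<Rightarrow> (max i j, min i j)) \<in> set (vecS_idx k)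
        then 1 * Z $$ (case ij of (i, j) \<Rightarrow> (max i j, min i j)) else 0)"
      using ij by (auto simp: set_idx max_def min_def)
  qed (auto simp: distinct_idx sym_mats_def)
  moreover have "(\<forall>Z \<in> sym_mats k. vec_mat Z = J *\<^sub>v entries_at (vecS_idx k) Z)
      \<longleftrightarrow> (\<forall>Z \<in> sym_mats k. vec_mat Z = J *\<^sub>v vecS Z)" for J
    by (intro ball_cong) (auto simp: vecS_def sym_mats_def)
  ultimately have "\<exists>!J. J \<in> carrier_mat (k\<^sup>2) (k * (k + 1) div 2) \<and>
    (\<forall>Z \<in> sym_mats k. vec_mat Z = J *\<^sub>v vecS Z)"
    by (simp only: length_idx)
  from theI'[OF this]
  show "J_S k \<in> carrier_mat (k\<^sup>2) (k * (k + 1) div 2)"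
    "Z \<in> sym_mats k \<Longrightarrow> vec_mat Z = J_S k *\<^sub>v vecS Z"
    unfolding J_S_def by blast+
qed

lemma J_SK_spec:
  "J_SK k \<in> carrier_mat (k\<^sup>2) (k * (k - 1) div 2)"
  "Z \<in> skew_mats k \<Longrightarrow> vec_mat Z = J_SK k *\<^sub>v vecSK Z"
proof -
  have "\<exists>!J. J \<in> carrier_mat (k\<^sup>2) (length (vecSK_idx k)) \<and>
    (\<forall>Z \<in> skew_mats k. vec_mat Z = J *\<^sub>v entries_at (vecSK_idx k) Z)"
  proof (rule ex1_duplication[where c = "\<lambda>(i, j). if j < i then 1 else - 1"
        and x = "\<lambda>(i, j). (max i j, min i j)"])
    fix f :: "nat \<times> nat \<Rightarrow> real"
    let ?Z = "mat k k (\<lambda>(i, j). if j < i then f (i, j) else if i < j then - f (j, i) else 0)"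
    have "?Z \<in> skew_mats k"
      by (auto simp: skew_mats_def)
    moreover have "\<forall>ij \<in> set (vecSK_idx k). ?Z $$ ij = f ij"
      by (auto simp: set_idx)
    ultimately show "\<exists>Z \<in> skew_mats k. \<forall>ij \<in> set (vecSK_idx k). Z $$ ij = f ij" by blast
  next
    fix Z ij assume "Z \<in> skew_mats k" and ij: "ij \<in> {..<k} \<times> {..<k}"
    then have Z: "Z \<in> carrier_mat k k" "Z\<^sup>T = - Z" by (auto simp: skew_mats_def)
    obtain i j where [simp]: "ij = (i, j)" by (cases ij)
    have "Z $$ (i, j) = - Z $$ (j, i)"
      using ij Z(1) arg_cong[OF Z(2), of "\<lambda>A. A $$ (j, i)"] by auto
    then show "Z $$ ij = (if (case ij of (i, j) \<Rightarrow> (max i j, min i j)) \<in> set (vecSK_idx k)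
        then (case ij of (i, j) \<Rightarrow> if j < i then 1 else - 1)
          * Z $$ (case ij of (i, j) \<Rightarrow> (max i j, min i j)) else 0)"
      using ij by (cases i j rule: linorder_cases) (auto simp: set_idx)
  qed (auto simp: distinct_idx skew_mats_def)
  moreover have "(\<forall>Z \<in> skew_mats k. vec_mat Z = J *\<^sub>v entries_at (vecSK_idx k) Z)
      \<longleftrightarrow> (\<forall>Z \<in> skew_mats k. vec_mat Z = J *\<^sub>v vecSK Z)" for J
    by (intro ball_cong) (auto simp: vecSK_def skew_mats_def)
  ultimately have "\<exists>!J. J \<in> carrier_mat (k\<^sup>2) (k * (k - 1) div 2) \<and>
    (\<forall>Z \<in> skew_mats k. vec_mat Z = J *\<^sub>v vecSK Z)"
    by (simp only: length_idx)
  from theI'[OF this]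
  show "J_SK k \<in> carrier_mat (k\<^sup>2) (k * (k - 1) div 2)"
    "Z \<in> skew_mats k \<Longrightarrow> vec_mat Z = J_SK k *\<^sub>v vecSK Z"
    unfolding J_SK_def by blast+
qed

end

theory Submission
  imports Defs
begin

text \<open>List the real and imaginary parts of a perturbation as a real vector, weighted so that its
  Euclidean norm is the weighted norm of the perturbation: this bijects the perturbations with
  Hermitian \<open>\<Delta>E\<close> onto the whole real space.  In these coordinates the perturbed saddle point
  system for the masked perturbation is the linear system with coefficient matrix \<open>M\<close> and right-hand
  side \<open>b\<close>.  Masking does not increase the norm, hence the backward error is the norm of the
  shortest solution of that system.  The blocks \<open>I1\<close> and \<open>I2\<close> give \<open>M\<close> full row
  rank, so the shortest solution is \<open>M\<^sup>T (M M\<^sup>T)\<^sup>-\<^sup>1 b\<close>.\<close>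

section \<open>Least-norm solutions\<close>

text \<open>The Hermitian constraint and the passage from \<open>F\<close> to its adjoint are linear
  over the reals but not over the complex numbers; this forces the split into real and imaginary
  parts. Every block of \<open>X1_hat\<close> and \<open>X2_hat\<close> contains one of the 0-1
  factors \<open>Phi_mat\<close>, \<open>Psi_mat\<close>, \<open>Sigma_mat\<close>, so
  \<open>M\<close> sees only the masked part of a perturbation. Hence the minimisation can run over
  all coordinate vectors instead of the subspace cut out by the pattern: masking a solution does not
  change its image under \<open>M\<close>. Feasibility asks that the masked \<open>dE\<close> be
  Hermitian and says nothing about \<open>dE\<close> off the pattern, so the lower bound takes the
  coordinates of the masked tuple. Attainment goes the other way, from a Hermitian \<open>dE\<close>
  to its mask, and uses that the pattern of a Hermitian \<open>E\<close> is symmetric. Full row rank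
  comes from solvability: \<open>dq\<close> and \<open>dr\<close> alone can produce any right-hand
  side, and a surjective \<open>M\<close> has an injective transpose.\<close>

lemma vec_norm2_nonneg [simp]: "0 \<le> vec_norm2 v"
  by (simp add: vec_norm2_def sum_nonneg)

lemma vec_norm2_sq: "(vec_norm2 v)\<^sup>2 = (\<Sum>i<dim_vec v. (norm (v $ i))\<^sup>2)"
  by (simp add: vec_norm2_def sum_nonneg)

lemma vec_norm2_sq_scalar_prod: "(vec_norm2 v)\<^sup>2 = v \<bullet> v" for v :: "real vec"
  unfolding vec_norm2_sq by (simp add: scalar_prod_def atLeast0LessThan power2_eq_square)

lemma scalar_prod_self_eq_0:
  fixes v :: "real vec"
  assumes "v \<in> carrier_vec n" "v \<bullet> v = 0"
  shows "v = 0\<^sub>v n"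
proof -
  have "(\<Sum>i<n. v $ i * v $ i) = 0"
    using assms by (auto simp: scalar_prod_def atLeast0LessThan)
  then have "\<forall>i<n. v $ i * v $ i = 0"
    by (subst (asm) sum_nonneg_eq_0_iff) auto
  then show ?thesis
    using assms(1) by (intro eq_vecI) auto
qed

text \<open>A nonzero determinant makes \<open>A\<close> a unit of the matrix ring, and
  \<open>mat_inverse\<close> returns \<open>None\<close> only for non-units, so the
  \<open>the\<close> in \<open>mat_inv\<close> is applied to a genuine inverse.\<close>

lemma mat_inv_nonsingular:
  fixes A :: "'a :: field mat"
  assumes A: "A \<in> carrier_mat n n" and "det A \<noteq> 0"
  shows "mat_inv A \<in> carrier_mat n n" "A * mat_inv A = 1\<^sub>m n" "mat_inv A * A = 1\<^sub>m n"
proof -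
  have "A \<in> Units (ring_mat TYPE('a) n ())"
    using assms by (rule det_non_zero_imp_unit)
  with mat_inverse(1)[OF A] obtain B where "mat_inverse A = Some B"
    by fastforce
  with mat_inverse(2)[OF A this]
  show "mat_inv A \<in> carrier_mat n n" "A * mat_inv A = 1\<^sub>m n" "mat_inv A * A = 1\<^sub>m n"
    by (simp_all add: mat_inv_def)
qed

text \<open>A one-sided inverse suffices because determinants multiply: \<open>det A\<close> divides
  1 and so is nonzero.\<close>

lemma mat_inv_unique:
  fixes A B :: "'a :: field mat"
  assumes A: "A \<in> carrier_mat n n" and B: "B \<in> carrier_mat n n" and AB: "A * B = 1\<^sub>m n"
  shows "mat_inv A = B"
proof -
  have "det A * det B = 1"
    using det_mult[OF A B] AB by simp
  then have "det A \<noteq> 0" by auto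
  note inv = mat_inv_nonsingular[OF A this]
  have "mat_inv A = mat_inv A * (A * B)"
    using inv(1) by (simp add: AB)
  also have "\<dots> = B"
    using inv A B by (subst assoc_mult_mat[symmetric]) auto
  finally show ?thesis .
qed

text \<open>The vector has the form \<open>y = M\<^sup>T *\<^sub>v w\<close>, hence is orthogonal to
  the kernel of \<open>M\<close>. Any other solution differs from it by a kernel element, and
  Pythagoras gives minimality. The hypothesis \<open>inj\<close> is full row rank of
  \<open>M\<close>.\<close>

lemma
  fixes M :: "real mat"
  assumes M: "M \<in> carrier_mat k l" and b: "b \<in> carrier_vec k"
    and inj: "\<And>v. v \<in> carrier_vec k \<Longrightarrow> M\<^sup>T *\<^sub>v v = 0\<^sub>v l \<Longrightarrow> v = 0\<^sub>v k"
  shows invertible_gram: "invertible_mat (M * M\<^sup>T)"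
    and least_norm_carrier: "M\<^sup>T * mat_inv (M * M\<^sup>T) *\<^sub>v b \<in> carrier_vec l"
    and least_norm_solves: "M *\<^sub>v (M\<^sup>T * mat_inv (M * M\<^sup>T) *\<^sub>v b) = b"
    and least_norm_least: "\<And>z. z \<in> carrier_vec l \<Longrightarrow> M *\<^sub>v z = b \<Longrightarrow>
      vec_norm2 (M\<^sup>T * mat_inv (M * M\<^sup>T) *\<^sub>v b) \<le> vec_norm2 z"
proof -
  let ?A = "M * M\<^sup>T"
  have A: "?A \<in> carrier_mat k k" and T: "M\<^sup>T \<in> carrier_mat l k" using M by auto
  have "det ?A \<noteq> 0"
  proof
    assume "det ?A = 0"
    then obtain v where v: "v \<in> carrier_vec k" "v \<noteq> 0\<^sub>v k" "?A *\<^sub>v v = 0\<^sub>v k"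
      using det_0_iff_vec_prod_zero_field[OF A] by blast
    have w: "M\<^sup>T *\<^sub>v v \<in> carrier_vec l" using M v by auto
    \<comment> \<open>A kernel vector of the Gram matrix is already killed by the transpose, because
      the quadratic form of the Gram matrix is a squared norm.\<close>
    have "(M\<^sup>T *\<^sub>v v) \<bullet> (M\<^sup>T *\<^sub>v v) = v \<bullet> (M *\<^sub>v (M\<^sup>T *\<^sub>v v))"
      by (rule transpose_vec_mult_scalar[OF M w v(1)])
    also have "M *\<^sub>v (M\<^sup>T *\<^sub>v v) = 0\<^sub>v k"
      using v assoc_mult_mat_vec[OF M T v(1)] by simp
    finally have "M\<^sup>T *\<^sub>v v = 0\<^sub>v l"
      using v(1) by (intro scalar_prod_self_eq_0[OF w]) simp
    with inj[OF v(1)] v(2) show False by simp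
  qed
  note inv = mat_inv_nonsingular[OF A this]
  show "invertible_mat ?A"
    unfolding invertible_mat_def inverts_mat_def
    using inv A by (intro conjI exI[of _ "mat_inv ?A"]) auto
  define w where "w = mat_inv ?A *\<^sub>v b"
  have w: "w \<in> carrier_vec k" using inv b by (auto simp: w_def)
  define y where "y = M\<^sup>T *\<^sub>v w"
  have y_eq: "M\<^sup>T * mat_inv ?A *\<^sub>v b = y"
    unfolding y_def w_def by (rule assoc_mult_mat_vec[OF T inv(1) b])
  have y: "y \<in> carrier_vec l" using T w by (auto simp: y_def)
  show "M\<^sup>T * mat_inv ?A *\<^sub>v b \<in> carrier_vec l" using y y_eq by simp
  have "M *\<^sub>v y = ?A *\<^sub>v w"
    unfolding y_def by (rule assoc_mult_mat_vec[OF M T w, symmetric])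
  also have "\<dots> = ?A * mat_inv ?A *\<^sub>v b"
    unfolding w_def by (rule assoc_mult_mat_vec[OF A inv(1) b, symmetric])
  finally have My: "M *\<^sub>v y = b" using inv(2) b by simp
  then show "M *\<^sub>v (M\<^sup>T * mat_inv ?A *\<^sub>v b) = b" using y_eq by simp
  fix z assume z: "z \<in> carrier_vec l" "M *\<^sub>v z = b"
  \<comment> \<open>Moving the transpose across the scalar product turns both sides into
    \<open>w\<close> against the common image \<open>b\<close>; so \<open>z - y\<close> is
    orthogonal to \<open>y\<close>.\<close>
  have "y \<bullet> z = w \<bullet> b" "y \<bullet> y = w \<bullet> b"
    using transpose_vec_mult_scalar[OF M _ w] z y My by (simp_all add: y_def)
  moreover have "(z - y) \<bullet> (z - y) = z \<bullet> z - y \<bullet> z - (y \<bullet> z - y \<bullet> y)"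
    using z y by (simp add: minus_scalar_prod_distrib[of _ l] scalar_prod_minus_distrib[of _ l]
        comm_scalar_prod[of z l y])
  moreover have "0 \<le> (z - y) \<bullet> (z - y)"
    by (simp flip: vec_norm2_sq_scalar_prod)
  ultimately have "(vec_norm2 y)\<^sup>2 \<le> (vec_norm2 z)\<^sup>2"
    by (simp add: vec_norm2_sq_scalar_prod)
  then show "vec_norm2 (M\<^sup>T * mat_inv ?A *\<^sub>v b) \<le> vec_norm2 z"
    unfolding y_eq by (rule power2_le_imp_le) simp
qed

section \<open>Block vectors and vectorization\<close>

lemma append_vec_assoc: "(a @\<^sub>v b) @\<^sub>v c = a @\<^sub>v (b @\<^sub>v c)"
  by (intro eq_vecI) auto

lemma append_cols_carrier [simp]:
  "A \<in> carrier_mat k a \<Longrightarrow> B \<in> carrier_mat k b \<Longrightarrow> A @\<^sub>c B \<in> carrier_mat k (a + b)"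
  by (intro carrier_matI) (auto simp: append_cols_def)

lemma append_cols_mult_vec:
  assumes "A \<in> carrier_mat k a" "B \<in> carrier_mat k b" "x \<in> carrier_vec a" "y \<in> carrier_vec b"
  shows "(A @\<^sub>c B) *\<^sub>v (x @\<^sub>v y) = A *\<^sub>v x + B *\<^sub>v y"
proof -
  \<comment> \<open>The lower blocks in \<open>append_cols\<close> have zero rows, so the second
    half of this product is the empty vector.\<close>
  have "(A @\<^sub>c B) *\<^sub>v (x @\<^sub>v y) = (A *\<^sub>v x + B *\<^sub>v y) @\<^sub>v (0\<^sub>m 0 a *\<^sub>v x + 0\<^sub>m 0 b *\<^sub>v y)"
    using assms by (simp add: append_cols_def four_block_mat_mult_vec[of _ k a _ b _ 0])
  also have "\<dots> = A *\<^sub>v x + B *\<^sub>v y"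
    using assms by (intro eq_vecI) auto
  finally show ?thesis .
qed

lemma vec_norm2_append: "(vec_norm2 (a @\<^sub>v b))\<^sup>2 = (vec_norm2 a)\<^sup>2 + (vec_norm2 b)\<^sup>2"
proof -
  have "(\<Sum>i<k + l. f i) = (\<Sum>i<k. f i) + (\<Sum>i<l. f (k + i))" for k l :: nat and f :: "nat \<Rightarrow> real"
    by (induction l) (simp_all add: add.assoc)
  then show ?thesis
    by (simp add: vec_norm2_sq)
qed

lemma vec_norm2_smult: "vec_norm2 (c \<cdot>\<^sub>v v) = \<bar>c\<bar> * vec_norm2 v" for c :: real
  by (simp add: vec_norm2_def power_mult_distrib real_sqrt_mult norm_mult flip: sum_distrib_left)

lemma vec_norm2_Re_Im:
  "(vec_norm2 v)\<^sup>2 = (vec_norm2 (map_vec Re v))\<^sup>2 + (vec_norm2 (map_vec Im v))\<^sup>2"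
  by (simp add: vec_norm2_sq cmod_power2 sum.distrib)

lemma frob_norm_sq: "(frob_norm A)\<^sup>2 = (\<Sum>i<dim_row A. \<Sum>j<dim_col A. (norm (A $$ (i, j)))\<^sup>2)"
  by (simp add: frob_norm_def sum_nonneg)

lemma frob_norm_sq_prod:
  "(frob_norm A)\<^sup>2 = (\<Sum>ij\<in>{..<dim_row A} \<times> {..<dim_col A}. (norm (A $$ ij))\<^sup>2)"
  by (simp add: frob_norm_sq sum.cartesian_product)

lemma frob_norm_Re_Im:
  "(frob_norm A)\<^sup>2 = (frob_norm (map_mat Re A))\<^sup>2 + (frob_norm (map_mat Im A))\<^sup>2"
  by (simp add: frob_norm_sq cmod_power2 sum.distrib)

lemma sum_nth_distinct:
  "distinct ps \<Longrightarrow> (\<Sum>t<length ps. f (ps ! t)) = (\<Sum>x\<in>set ps. f x)"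
  using sum.reindex_bij_betw[OF bij_betw_nth[of ps "{..<length ps}" "set ps"]] by simp

lemma distinct_vec_idx: "distinct (vec_idx a b)"
  using distinct_pairs[of "[0..<b]" "\<lambda>_. 0" a] by (simp add: vec_idx_def)

text \<open>Column-major order in closed form: the div/mod splitting is the one by which
  \<open>kron\<close> addresses its entries, so Kronecker factors can be matched with
  \<open>vec_mat\<close>.\<close>

lemma vec_idx_conv: "vec_idx a b = map (\<lambda>s. (s mod a, s div a)) [0..<a * b]"
proof (induction b)
  case (Suc b)
  have "vec_idx a (Suc b) = vec_idx a b @ map (\<lambda>i. (i, b)) [0..<a]"
    by (simp add: vec_idx_def)
  \<comment> \<open>The added column fills the positions from \<open>a * b\<close> to
    \<open>a * b + a - 1\<close>.\<close>
  also have "map (\<lambda>i. (i, b)) [0..<a] = map (\<lambda>s. (s mod a, s div a)) [a * b..<a * b + a]"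
    by (rule nth_equalityI) auto
  finally show ?case
    using Suc upt_add_eq_append[of 0 "a * b" a] by (simp add: add.commute)
qed (simp add: vec_idx_def)

lemma vec_mat_carrier [simp]: "Z \<in> carrier_mat a b \<Longrightarrow> vec_mat Z \<in> carrier_vec (a * b)"
  by (auto simp: vec_mat_def length_idx intro!: carrier_vecI)

lemma vec_mat_norm: "vec_norm2 (vec_mat Z) = frob_norm Z"
proof -
  have "(vec_norm2 (vec_mat Z))\<^sup>2 = (frob_norm Z)\<^sup>2"
    using sum_nth_distinct[OF distinct_vec_idx, of "\<lambda>ij. (norm (Z $$ ij))\<^sup>2"]
    by (simp add: vec_norm2_sq frob_norm_sq_prod vec_mat_def set_idx)
  then show ?thesis
    by (simp add: vec_norm2_def frob_norm_def sum_nonneg)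
qed

text \<open>The result is a function on index pairs and not a matrix, so that each use can extend it
  beyond \<open>ps\<close> in its own way: directly, symmetrically or skew-symmetrically.\<close>

lemma entries_at_surj:
  assumes "distinct ps" "y \<in> carrier_vec (length ps)"
  obtains f where "\<And>Z. (\<And>ij. ij \<in> set ps \<Longrightarrow> Z $$ ij = f ij) \<Longrightarrow> entries_at ps Z = y"
proof
  \<comment> \<open>Distinctness of \<open>ps\<close> makes the position of a listed pair unique, so
    this description is proper there.\<close>
  let ?f = "\<lambda>ij. y $ (THE t. t < length ps \<and> ps ! t = ij)"
  fix Z :: "'a mat" assume "\<And>ij. ij \<in> set ps \<Longrightarrow> Z $$ ij = ?f ij"
  moreover have "(THE t'. t' < length ps \<and> ps ! t' = ps ! t) = t" if "t < length ps" for t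
    using that assms(1) by (auto simp: nth_eq_iff_index_eq)
  ultimately show "entries_at ps Z = y"
    using assms(2) by (intro eq_vecI) auto
qed

lemma vec_mat_surj:
  assumes "y \<in> carrier_vec (a * b)"
  obtains Z where "Z \<in> carrier_mat a b" "vec_mat Z = y"
proof -
  have "y \<in> carrier_vec (length (vec_idx a b))" using assms by (simp add: length_idx)
  from entries_at_surj[OF distinct_vec_idx this] obtain f where
    f: "\<And>Z. (\<And>ij. ij \<in> set (vec_idx a b) \<Longrightarrow> Z $$ ij = f ij) \<Longrightarrow> entries_at (vec_idx a b) Z = y"
    by blast
  have "entries_at (vec_idx a b) (mat a b f) = y"
    by (rule f) (auto simp: set_idx)
  then show thesis
    by (intro that[of "mat a b f"]) (auto simp: vec_mat_def)
qed

section \<open>Kronecker products acting on vectorized matrices\<close>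

lemma vec_idx_nth:
  assumes "s < a * b"
  shows "vec_idx a b ! s = (s mod a, s div a)" "s mod a < a" "s div a < b"
proof -
  show "vec_idx a b ! s = (s mod a, s div a)"
    using assms by (simp add: vec_idx_conv)
  show "s mod a < a" using assms by (cases a) auto
  show "s div a < b" using assms by (simp add: less_mult_imp_div_less mult.commute)
qed

lemma row_mat_index [simp]:
  "dim_row (row_mat x) = 1" "dim_col (row_mat x) = dim_vec x"
  "j < dim_vec x \<Longrightarrow> row_mat x $$ (0, j) = x $ j"
  by (simp_all add: row_mat_def mat_of_rows_def)

lemma kron_dims [simp]:
  "dim_row (A \<otimes>\<^sub>k B) = dim_row A * dim_row B" "dim_col (A \<otimes>\<^sub>k B) = dim_col A * dim_col B"
  by (simp_all add: kron_def)

lemma dim_vec_mat [simp]: "dim_vec (vec_mat Z) = dim_row Z * dim_col Z"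
  by (simp add: vec_mat_def length_idx)

lemma sum_Times: "(\<Sum>ij\<in>A \<times> B. f ij) = (\<Sum>i\<in>A. \<Sum>j\<in>B. f (i, j))"
  by (simp add: sum.cartesian_product)

text \<open>The case of one column \<open>x\<close> and left factor the identity in the rule that
  vec of \<open>A * Z * B\<close> is the Kronecker product of the transpose of \<open>B\<close> with
  \<open>A\<close>, applied to vec of \<open>Z\<close>.\<close>

lemma kron_row_one_mult_vec:
  fixes Z :: "'a :: comm_semiring_1 mat"
  assumes Z: "Z \<in> carrier_mat k d" and x: "x \<in> carrier_vec d"
  shows "(row_mat x \<otimes>\<^sub>k 1\<^sub>m k) *\<^sub>v vec_mat Z = Z *\<^sub>v x"
proof (rule eq_vecI)
  fix i assume "i < dim_vec (Z *\<^sub>v x)"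
  then have i: "i < k" using Z by simp
  \<comment> \<open>The identity factor keeps only the entries of row \<open>i\<close>. Written on
    index pairs, the sum over positions becomes a sum over the full grid.\<close>
  let ?g = "\<lambda>(i', j). if i' = i then Z $$ (i, j) * x $ j else 0"
  have dims: "dim_row Z = k" "dim_col Z = d" "dim_vec x = d" using Z x by auto
  have "((row_mat x \<otimes>\<^sub>k 1\<^sub>m k) *\<^sub>v vec_mat Z) $ i
      = (\<Sum>s<k * d. (row_mat x \<otimes>\<^sub>k 1\<^sub>m k) $$ (i, s) * vec_mat Z $ s)"
    using i by (subst index_mult_mat_vec)
      (auto simp: scalar_prod_def atLeast0LessThan length_idx dims
        mult.commute[of d k] intro!: sum.cong)
  also have "\<dots> = (\<Sum>s<k * d. ?g (vec_idx k d ! s))"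
  proof (rule sum.cong)
    fix s assume "s \<in> {..<k * d}"
    then have s: "s < k * d" "s < d * k" by (simp_all add: mult.commute)
    then show "(row_mat x \<otimes>\<^sub>k 1\<^sub>m k) $$ (i, s) * vec_mat Z $ s = ?g (vec_idx k d ! s)"
      using i vec_idx_nth[OF s(1)]
      by (simp add: kron_def vec_mat_def length_idx dims mult.commute)
  qed simp
  also have "\<dots> = (\<Sum>ij\<in>{..<k} \<times> {..<d}. ?g ij)"
    using sum_nth_distinct[OF distinct_vec_idx[of k d], of ?g]
    by (simp only: length_idx set_idx)
  also have "\<dots> = (\<Sum>j<d. \<Sum>i'<k. ?g (i', j))"
    unfolding sum_Times by (rule sum.swap)
  also have "\<dots> = (Z *\<^sub>v x) $ i"
    using i by (simp add: scalar_prod_def atLeast0LessThan dims)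
  finally show "((row_mat x \<otimes>\<^sub>k 1\<^sub>m k) *\<^sub>v vec_mat Z) $ i = (Z *\<^sub>v x) $ i" .
qed (use Z in \<open>simp add: kron_def\<close>)

text \<open>The mirror case of the same vectorization rule, with the row \<open>x\<close> as left
  factor. It supplies the transposes needed for the adjoint of \<open>dF\<close>.\<close>

lemma kron_one_row_mult_vec:
  fixes Z :: "'a :: comm_semiring_1 mat"
  assumes Z: "Z \<in> carrier_mat d k" and x: "x \<in> carrier_vec d"
  shows "(1\<^sub>m k \<otimes>\<^sub>k row_mat x) *\<^sub>v vec_mat Z = Z\<^sup>T *\<^sub>v x"
proof (rule eq_vecI)
  fix i assume "i < dim_vec (Z\<^sup>T *\<^sub>v x)"
  then have i: "i < k" using Z by simp
  let ?g = "\<lambda>(i', j). if j = i then Z $$ (i', i) * x $ i' else 0"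
  have dims: "dim_row Z = d" "dim_col Z = k" "dim_vec x = d" using Z x by auto
  have "((1\<^sub>m k \<otimes>\<^sub>k row_mat x) *\<^sub>v vec_mat Z) $ i
      = (\<Sum>s<d * k. (1\<^sub>m k \<otimes>\<^sub>k row_mat x) $$ (i, s) * vec_mat Z $ s)"
    using i by (subst index_mult_mat_vec)
      (auto simp: scalar_prod_def atLeast0LessThan length_idx dims
        mult.commute[of k d] intro!: sum.cong)
  also have "\<dots> = (\<Sum>s<d * k. ?g (vec_idx d k ! s))"
  proof (rule sum.cong)
    fix s assume "s \<in> {..<d * k}"
    then have s: "s < d * k" "s < k * d" by (simp_all add: mult.commute)
    then show "(1\<^sub>m k \<otimes>\<^sub>k row_mat x) $$ (i, s) * vec_mat Z $ s = ?g (vec_idx d k ! s)"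
      using i vec_idx_nth[OF s(1)]
      by (simp add: kron_def vec_mat_def length_idx dims mult.commute)
  qed simp
  also have "\<dots> = (\<Sum>ij\<in>{..<d} \<times> {..<k}. ?g ij)"
    using sum_nth_distinct[OF distinct_vec_idx[of d k], of ?g]
    by (simp only: length_idx set_idx)
  also have "\<dots> = (\<Sum>i'<d. \<Sum>j<k. ?g (i', j))"
    unfolding sum_Times ..
  also have "\<dots> = (Z\<^sup>T *\<^sub>v x) $ i"
    using i by (simp add: scalar_prod_def atLeast0LessThan dims)
  finally show "((1\<^sub>m k \<otimes>\<^sub>k row_mat x) *\<^sub>v vec_mat Z) $ i = (Z\<^sup>T *\<^sub>v x) $ i" .
qed (use Z in \<open>simp add: kron_def\<close>)

lemma mat_diag_mult_vec:
  "v \<in> carrier_vec k \<Longrightarrow> mat_diag k d *\<^sub>v v = vec k (\<lambda>i. d i * v $ i)"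
  for v :: "'a :: semiring_1 vec"
  by (intro eq_vecI) (auto simp: mat_diag_def scalar_prod_def if_distrib[of "\<lambda>x. x * _"] cong: if_cong)

section \<open>Sparsity patterns and Hermitian matrices\<close>

lemma hadamard_dims [simp]:
  "dim_row (A \<odot>\<^sub>m B) = dim_row A" "dim_col (A \<odot>\<^sub>m B) = dim_col A"
  "A \<in> carrier_mat k l \<Longrightarrow> A \<odot>\<^sub>m B \<in> carrier_mat k l"
  "i < dim_row A \<Longrightarrow> j < dim_col A \<Longrightarrow> (A \<odot>\<^sub>m B) $$ (i, j) = A $$ (i, j) * B $$ (i, j)"
  by (auto simp: hadamard_def)

lemma Theta_dims [simp]:
  "dim_row (Theta X) = dim_row X" "dim_col (Theta X) = dim_col X"
  "i < dim_row X \<Longrightarrow> j < dim_col X \<Longrightarrow> Theta X $$ (i, j) = (if X $$ (i, j) = 0 then 0 else 1)"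
  by (auto simp: Theta_def)

lemma mat_adjoint_dims [simp]:
  "dim_row (mat_adjoint A) = dim_col A" "dim_col (mat_adjoint A) = dim_row A"
  "i < dim_col A \<Longrightarrow> j < dim_row A \<Longrightarrow> mat_adjoint A $$ (i, j) = conjugate (A $$ (j, i))"
  by (auto simp: mat_adjoint_def mat_of_rows_def)

lemma hermitian_mat_index:
  assumes "hermitian_mat A" "A \<in> carrier_mat k k" "i < k" "j < k"
  shows "A $$ (i, j) = cnj (A $$ (j, i))"
  using assms mat_adjoint_dims(3)[of i A j] by (auto simp: hermitian_mat_def)

lemma hermitian_matI:
  assumes "A \<in> carrier_mat k k" "\<And>i j. i < k \<Longrightarrow> j < k \<Longrightarrow> A $$ (i, j) = cnj (A $$ (j, i))"
  shows "hermitian_mat A"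
proof -
  have "mat_adjoint A = A"
  proof (rule eq_matI)
    fix i j assume "i < dim_row A" "j < dim_col A"
    then show "mat_adjoint A $$ (i, j) = A $$ (i, j)"
      using assms(1) assms(2)[of i j] by simp
  qed (use assms(1) in auto)
  with assms(1) show ?thesis by (simp add: hermitian_mat_def)
qed

text \<open>Conjugation preserves being zero, so a Hermitian \<open>E\<close> has a symmetric
  pattern, and the mask treats mirrored entries alike.\<close>

lemma hermitian_hadamard_Theta:
  assumes "hermitian_mat A" "hermitian_mat E" "A \<in> carrier_mat k k" "E \<in> carrier_mat k k"
  shows "hermitian_mat (A \<odot>\<^sub>m Theta E)"
proof (rule hermitian_matI)
  fix i j assume "i < k" "j < k"
  with assms hermitian_mat_index[of A k i j] hermitian_mat_index[of E k i j]
  show "(A \<odot>\<^sub>m Theta E) $$ (i, j) = cnj ((A \<odot>\<^sub>m Theta E) $$ (j, i))" by auto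
qed (use assms in simp)

lemma hermitian_Re_Im:
  assumes "hermitian_mat A" "A \<in> carrier_mat k k"
  shows "map_mat Re A \<in> sym_mats k" "map_mat Im A \<in> skew_mats k"
proof -
  note index = hermitian_mat_index[OF assms]
  show "map_mat Re A \<in> sym_mats k"
    unfolding sym_mats_def
  proof (intro CollectI conjI eq_matI)
    fix i j assume "i < dim_row (map_mat Re A)" "j < dim_col (map_mat Re A)"
    then show "(map_mat Re A)\<^sup>T $$ (i, j) = map_mat Re A $$ (i, j)"
      using assms(2) index[of i j] by simp
  qed (use assms(2) in auto)
  show "map_mat Im A \<in> skew_mats k"
    unfolding skew_mats_def
  proof (intro CollectI conjI eq_matI)
    fix i j assume "i < dim_row (- map_mat Im A)" "j < dim_col (- map_mat Im A)"
    then show "(map_mat Im A)\<^sup>T $$ (i, j) = (- map_mat Im A) $$ (i, j)"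
      using assms(2) index[of i j] by simp
  qed (use assms(2) in auto)
qed

lemma sym_mats_index: "Z \<in> sym_mats k \<Longrightarrow> i < k \<Longrightarrow> j < k \<Longrightarrow> Z $$ (i, j) = Z $$ (j, i)"
  by (metis (mono_tags, lifting) carrier_matD index_transpose_mat(1) mem_Collect_eq sym_mats_def)

lemma skew_mats_index: "Z \<in> skew_mats k \<Longrightarrow> i < k \<Longrightarrow> j < k \<Longrightarrow> Z $$ (i, j) = - Z $$ (j, i)"
proof -
  assume Z: "Z \<in> skew_mats k" and ij: "i < k" "j < k"
  then have "Z\<^sup>T $$ (j, i) = (- Z) $$ (j, i)" "Z \<in> carrier_mat k k" by (auto simp: skew_mats_def)
  with ij show ?thesis by simp
qed

lemma sym_mats_carrier: "Z \<in> sym_mats k \<Longrightarrow> Z \<in> carrier_mat k k"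
  and skew_mats_carrier: "Z \<in> skew_mats k \<Longrightarrow> Z \<in> carrier_mat k k"
  by (simp_all add: sym_mats_def skew_mats_def)

lemma hadamard_Theta_sym:
  assumes "Z \<in> sym_mats k" "hermitian_mat E" "E \<in> carrier_mat k k"
  shows "Z \<odot>\<^sub>m Theta E \<in> sym_mats k"
  unfolding sym_mats_def
proof (intro CollectI conjI eq_matI)
  note Z = sym_mats_carrier[OF assms(1)]
  show "Z \<odot>\<^sub>m Theta E \<in> carrier_mat k k" using Z by simp
  fix i j assume "i < dim_row (Z \<odot>\<^sub>m Theta E)" "j < dim_col (Z \<odot>\<^sub>m Theta E)"
  then show "(Z \<odot>\<^sub>m Theta E)\<^sup>T $$ (i, j) = (Z \<odot>\<^sub>m Theta E) $$ (i, j)"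
    using Z assms hermitian_mat_index[of E k i j] sym_mats_index[of Z k i j] by auto
qed (use sym_mats_carrier[OF assms(1)] in auto)

lemma hadamard_Theta_skew:
  assumes "Z \<in> skew_mats k" "hermitian_mat E" "E \<in> carrier_mat k k"
  shows "Z \<odot>\<^sub>m Theta E \<in> skew_mats k"
  unfolding skew_mats_def
proof (intro CollectI conjI eq_matI)
  note Z = skew_mats_carrier[OF assms(1)]
  show "Z \<odot>\<^sub>m Theta E \<in> carrier_mat k k" using Z by simp
  fix i j assume "i < dim_row (- (Z \<odot>\<^sub>m Theta E))" "j < dim_col (- (Z \<odot>\<^sub>m Theta E))"
  then show "(Z \<odot>\<^sub>m Theta E)\<^sup>T $$ (i, j) = (- (Z \<odot>\<^sub>m Theta E)) $$ (i, j)"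
    using Z assms hermitian_mat_index[of E k i j] skew_mats_index[of Z k i j] by auto
qed (use skew_mats_carrier[OF assms(1)] in auto)

text \<open>Two index lists are allowed because \<open>Psi_mat\<close> reads the pattern in the
  upper triangle while \<open>vecSK\<close> reads the matrix in the lower one; it is enough that
  \<open>W\<close> agrees at corresponding positions.\<close>

lemma diag_of_entries_mult_vec:
  fixes Z :: "'a :: comm_semiring_1 mat"
  assumes "length qs = length ps" "set ps \<subseteq> {..<dim_row Z} \<times> {..<dim_col Z}"
    and "\<And>t. t < length ps \<Longrightarrow> W $$ (qs ! t) = W $$ (ps ! t)"
  shows "diag_of (entries_at qs W) *\<^sub>v entries_at ps Z = entries_at ps (Z \<odot>\<^sub>m W)"
proof (rule eq_vecI)
  fix t assume "t < dim_vec (entries_at ps (Z \<odot>\<^sub>m W))"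
  then have t: "t < length ps" by simp
  have "ps ! t \<in> {..<dim_row Z} \<times> {..<dim_col Z}"
    using assms(2) nth_mem[OF t] by blast
  with t assms(1,3) show "(diag_of (entries_at qs W) *\<^sub>v entries_at ps Z) $ t = entries_at ps (Z \<odot>\<^sub>m W) $ t"
    by (cases "ps ! t") (simp add: diag_of_def mat_diag_mult_vec carrier_vecI mult.commute)
qed (use assms(1) in \<open>simp add: diag_of_def mat_diag_def\<close>)

section \<open>The diagonal pattern matrices as masks\<close>

lemma Sigma_mat_mult_vec:
  assumes "X \<in> carrier_mat k l" "Z \<in> carrier_mat k l"
  shows "Sigma_mat X *\<^sub>v vec_mat Z = vec_mat (Z \<odot>\<^sub>m Theta X)"
  using assms by (auto simp: Sigma_mat_def vec_mat_def set_idx intro!: diag_of_entries_mult_vec)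

lemma Sigma_mat_carrier [simp]: "X \<in> carrier_mat k l \<Longrightarrow> Sigma_mat X \<in> carrier_mat (k * l) (k * l)"
  by (auto simp: Sigma_mat_def diag_of_def mat_diag_def)

lemma Phi_mat_carrier [simp]:
  "X \<in> carrier_mat k k \<Longrightarrow> Phi_mat X \<in> carrier_mat (k * (k + 1) div 2) (k * (k + 1) div 2)"
  by (auto simp: Phi_mat_def diag_of_def mat_diag_def vecS_def length_idx)

lemma vecS_carrier [simp]: "Z \<in> carrier_mat k k \<Longrightarrow> vecS Z \<in> carrier_vec (k * (k + 1) div 2)"
  by (auto simp: vecS_def length_idx intro!: carrier_vecI)

lemma vecSK_carrier [simp]: "Z \<in> carrier_mat k k \<Longrightarrow> vecSK Z \<in> carrier_vec (k * (k - 1) div 2)"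
  by (auto simp: vecSK_def length_idx intro!: carrier_vecI)

lemma Phi_mat_mult_vec:
  assumes "X \<in> carrier_mat k k" "Z \<in> carrier_mat k k"
  shows "Phi_mat X *\<^sub>v vecS Z = vecS (Z \<odot>\<^sub>m Theta X)"
  using assms by (auto simp: Phi_mat_def vecS_def set_idx intro!: diag_of_entries_mult_vec)

text \<open>Reading the strict upper triangle by rows is reading the strict lower triangle by
  columns with the coordinates swapped.\<close>

lemma Psi_idx: "[(i, j). i \<leftarrow> [0..<k], j \<leftarrow> [Suc i..<k]] = map prod.swap (vecSK_idx k)"
  by (simp add: vecSK_idx_def map_concat comp_def)

lemma Psi_mat_carrier [simp]:
  "X \<in> carrier_mat k k \<Longrightarrow> Psi_mat X \<in> carrier_mat (k * (k - 1) div 2) (k * (k - 1) div 2)"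
  unfolding Psi_mat_def Psi_idx by (auto simp: diag_of_def mat_diag_def length_idx)

lemma Psi_mat_mult_vec:
  assumes "hermitian_mat X" "X \<in> carrier_mat k k" "Z \<in> carrier_mat k k"
  shows "Psi_mat X *\<^sub>v vecSK Z = vecSK (Z \<odot>\<^sub>m Theta X)"
proof -
  have "Psi_mat X *\<^sub>v vecSK Z = entries_at (vecSK_idx k) (Z \<odot>\<^sub>m Theta X)"
    unfolding Psi_mat_def Psi_idx vecSK_def
  proof (subst diag_of_entries_mult_vec)
    fix t assume "t < length (vecSK_idx (dim_row Z))"
    then have t: "t < length (vecSK_idx k)" using assms by simp
    obtain i j where ij: "vecSK_idx k ! t = (i, j)" by force
    with nth_mem[OF t] have "i < k" "j < k" by (auto simp: set_idx)
    \<comment> \<open>Here the symmetry of the pattern enters: for Hermitian \<open>X\<close>,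
      mirrored entries vanish together.\<close>
    then show "Theta X $$ (map prod.swap (vecSK_idx (dim_row X)) ! t) =
        Theta X $$ (vecSK_idx (dim_row Z) ! t)"
      using assms t ij hermitian_mat_index[of X k i j] by auto
  qed (use assms in \<open>auto simp: set_idx\<close>)
  then show ?thesis using assms by (simp add: vecSK_def)
qed

text \<open>The columns before column \<open>j\<close> of the lower triangle have \<open>k\<close>,
  \<open>k - 1\<close>, ..., \<open>k - j + 1\<close> entries, and column \<open>j\<close> starts
  with its diagonal entry. The total of these lengths is therefore the position of
  \<open>(j, j)\<close>.\<close>

lemma vecS_idx_nth_diag:
  assumes "j < k"
  shows "(2 * k + 1 - j) * j div 2 < length (vecS_idx k)"
    "vecS_idx k ! ((2 * k + 1 - j) * j div 2) = (j, j)"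
proof -
  define col where "col j = map (\<lambda>i. (i, j)) [j..<k]" for j
  have len: "length (concat (map col [0..<j])) = (2 * k + 1 - j) * j div 2" if "j \<le> k" for j
    using that
  proof (induction j)
    case (Suc j)
    \<comment> \<open>Writing \<open>k\<close> through \<open>d\<close> removes the truncated
      subtractions. The next identity is for the doubled lengths, so that halving adds exactly
      \<open>k - j\<close>.\<close>
    obtain d where d: "k = Suc j + d" using Suc.prems le_Suc_ex by blast
    have "(2 * k + 1 - Suc j) * Suc j = (2 * k + 1 - j) * j + 2 * (k - j)"
      by (simp add: d algebra_simps)
    with Suc show ?case by (simp add: col_def)
  qed simp
  have "[0..<k] = [0..<j] @ j # [Suc j..<k]"
    using assms by (metis le_add_same_cancel1 less_imp_le_nat upt_add_eq_append upt_conv_Cons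
        zero_le le_add_diff_inverse)
  moreover have "vecS_idx k = concat (map col [0..<k])"
    by (simp add: vecS_idx_def col_def[abs_def])
  ultimately have "vecS_idx k = concat (map col [0..<j]) @ (j, j) #
      map (\<lambda>i. (i, j)) [Suc j..<k] @ concat (map col [Suc j..<k])"
    using assms by (simp add: col_def upt_conv_Cons)
  then show "(2 * k + 1 - j) * j div 2 < length (vecS_idx k)"
    "vecS_idx k ! ((2 * k + 1 - j) * j div 2) = (j, j)"
    using len[of j] assms by (simp_all add: nth_append)
qed

text \<open>Trades the position formula for a test on the listed pair. The formula counts from 1, so
  its \<open>i\<close> is column \<open>i - 1\<close> here.\<close>

lemma D_S_conv:
  "D_S k = mat_diag (k * (k + 1) div 2)
     (\<lambda>t. if fst (vecS_idx k ! t) = snd (vecS_idx k ! t) then 1 else sqrt 2)"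
proof -
  have "(\<exists>i\<in>{1..k}. Suc t = (2 * k + 2 - i) * (i - 1) div 2 + 1) \<longleftrightarrow>
      fst (vecS_idx k ! t) = snd (vecS_idx k ! t)" (is "?L \<longleftrightarrow> ?R") if "t < k * (k + 1) div 2" for t
  proof
    assume ?L
    then obtain i where i: "i \<in> {1..k}" "t = (2 * k + 2 - i) * (i - 1) div 2" by auto
    moreover have "2 * k + 2 - i = 2 * k + 1 - (i - 1)" using i by auto
    ultimately show ?R
      using vecS_idx_nth_diag(2)[of "i - 1" k] by auto
  next
    assume ?R
    have t: "t < length (vecS_idx k)" using that by (simp add: length_idx)
    from \<open>?R\<close> obtain j where j: "vecS_idx k ! t = (j, j)" by (metis prod.collapse)
    with nth_mem[OF t] have "j < k" by (auto simp: set_idx)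
    \<comment> \<open>Each pair occurs once in the list, so equal pairs force equal
      positions.\<close>
    with vecS_idx_nth_diag[OF this] t j have "t = (2 * k + 1 - j) * j div 2"
      using nth_eq_iff_index_eq[OF distinct_idx(1)] by metis
    with \<open>j < k\<close> show ?L
      by (intro bexI[of _ "Suc j"]) auto
  qed
  then show ?thesis
    unfolding D_S_def mat_diag_def by (intro eq_matI) auto
qed

lemma D_S_carrier [simp]: "D_S k \<in> carrier_mat (k * (k + 1) div 2) (k * (k + 1) div 2)"
  and D_SK_carrier [simp]: "D_SK k \<in> carrier_mat (k * (k - 1) div 2) (k * (k - 1) div 2)"
  by (simp_all add: D_S_def D_SK_def)

lemma mat_inv_mat_diag:
  fixes d :: "nat \<Rightarrow> 'a :: field"
  assumes "\<And>i. i < k \<Longrightarrow> d i \<noteq> 0"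
  shows "mat_inv (mat_diag k d) * mat_diag k d = 1\<^sub>m k" "mat_inv (mat_diag k d) \<in> carrier_mat k k"
proof -
  have "mat_diag k d * mat_diag k (\<lambda>i. inverse (d i)) = 1\<^sub>m k"
    "mat_diag k (\<lambda>i. inverse (d i)) * mat_diag k d = 1\<^sub>m k"
    unfolding mat_diag_diag using assms by (auto simp: mat_diag_def intro!: eq_matI)
  moreover from this(1) have "mat_inv (mat_diag k d) = mat_diag k (\<lambda>i. inverse (d i))"
    by (intro mat_inv_unique) simp_all
  ultimately show "mat_inv (mat_diag k d) * mat_diag k d = 1\<^sub>m k" "mat_inv (mat_diag k d) \<in> carrier_mat k k"
    by simp_all
qed

lemma D_SK_conv: "D_SK k = mat_diag (k * (k - 1) div 2) (\<lambda>_. sqrt 2)"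
  by (intro eq_matI) (auto simp: D_SK_def mat_diag_def)

lemma mat_inv_D:
  "mat_inv (D_S k) * D_S k = 1\<^sub>m (k * (k + 1) div 2)"
  "mat_inv (D_S k) \<in> carrier_mat (k * (k + 1) div 2) (k * (k + 1) div 2)"
  "mat_inv (D_SK k) * D_SK k = 1\<^sub>m (k * (k - 1) div 2)"
  "mat_inv (D_SK k) \<in> carrier_mat (k * (k - 1) div 2) (k * (k - 1) div 2)"
  unfolding D_S_conv D_SK_conv by (intro mat_inv_mat_diag; simp)+

lemma N1_carrier [simp]: "E \<in> carrier_mat k k \<Longrightarrow> N1 E \<in> carrier_mat (k\<^sup>2) (k * (k + 1) div 2)"
  unfolding N1_def by (metis J_S_spec(1) Phi_mat_carrier mat_inv_D(2) mult_carrier_mat carrier_matD(1))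

lemma N2_carrier [simp]: "E \<in> carrier_mat k k \<Longrightarrow> N2 E \<in> carrier_mat (k\<^sup>2) (k * (k - 1) div 2)"
  unfolding N2_def by (metis J_SK_spec(1) Psi_mat_carrier mat_inv_D(4) mult_carrier_mat carrier_matD(1))

text \<open>Read from the right: the inverse of \<open>D_S\<close> cancels the weights of the
  coordinates, \<open>Phi_mat\<close> masks the lower triangle, and \<open>J_S\<close> expands it to
  the full matrix. The last step is legitimate because the masked matrix is again symmetric.
  \<open>N2\<close> works likewise for skew-symmetric matrices.\<close>

lemma N1_mult_vec:
  assumes E: "E \<in> carrier_mat k k" "hermitian_mat E" and Z: "Z \<in> sym_mats k"
  shows "N1 E *\<^sub>v (D_S k *\<^sub>v vecS Z) = vec_mat (Z \<odot>\<^sub>m Theta E)"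
proof -
  let ?N = "k * (k + 1) div 2"
  note c = J_S_spec(1)[of k] Phi_mat_carrier[OF E(1)] mat_inv_D(2)[of k] D_S_carrier[of k]
    vecS_carrier[OF sym_mats_carrier[OF Z]]
  have dim: "dim_row E = k" using E by simp
  have "N1 E *\<^sub>v (D_S k *\<^sub>v vecS Z) = J_S k * Phi_mat E *\<^sub>v (mat_inv (D_S k) *\<^sub>v (D_S k *\<^sub>v vecS Z))"
    unfolding N1_def dim using c
    by (intro assoc_mult_mat_vec[of _ _ ?N _ ?N] mult_carrier_mat[of _ _ ?N] mult_mat_vec_carrier[of _ ?N ?N])
  also have "mat_inv (D_S k) *\<^sub>v (D_S k *\<^sub>v vecS Z) = vecS Z"
    using c by (subst assoc_mult_mat_vec[symmetric, of _ ?N ?N _ ?N]) (auto simp: mat_inv_D)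
  also have "J_S k * Phi_mat E *\<^sub>v vecS Z = J_S k *\<^sub>v (Phi_mat E *\<^sub>v vecS Z)"
    using c by (intro assoc_mult_mat_vec)
  also have "\<dots> = vec_mat (Z \<odot>\<^sub>m Theta E)"
    using J_S_spec(2)[OF hadamard_Theta_sym[OF Z E(2,1)]] Phi_mat_mult_vec[OF E(1) sym_mats_carrier[OF Z]]
    by simp
  finally show ?thesis .
qed

lemma N2_mult_vec:
  assumes E: "E \<in> carrier_mat k k" "hermitian_mat E" and Z: "Z \<in> skew_mats k"
  shows "N2 E *\<^sub>v (D_SK k *\<^sub>v vecSK Z) = vec_mat (Z \<odot>\<^sub>m Theta E)"
proof -
  let ?N = "k * (k - 1) div 2"
  note c = J_SK_spec(1)[of k] Psi_mat_carrier[OF E(1)] mat_inv_D(4)[of k] D_SK_carrier[of k]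
    vecSK_carrier[OF skew_mats_carrier[OF Z]]
  have dim: "dim_row E = k" using E by simp
  have "N2 E *\<^sub>v (D_SK k *\<^sub>v vecSK Z) = J_SK k * Psi_mat E *\<^sub>v (mat_inv (D_SK k) *\<^sub>v (D_SK k *\<^sub>v vecSK Z))"
    unfolding N2_def dim using c
    by (intro assoc_mult_mat_vec[of _ _ ?N _ ?N] mult_carrier_mat[of _ _ ?N] mult_mat_vec_carrier[of _ ?N ?N])
  also have "mat_inv (D_SK k) *\<^sub>v (D_SK k *\<^sub>v vecSK Z) = vecSK Z"
    using c by (subst assoc_mult_mat_vec[symmetric, of _ ?N ?N _ ?N]) (auto simp: mat_inv_D)
  also have "J_SK k * Psi_mat E *\<^sub>v vecSK Z = J_SK k *\<^sub>v (Psi_mat E *\<^sub>v vecSK Z)"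
    using c by (intro assoc_mult_mat_vec)
  also have "\<dots> = vec_mat (Z \<odot>\<^sub>m Theta E)"
    using J_SK_spec(2)[OF hadamard_Theta_skew[OF Z E(2,1)]]
      Psi_mat_mult_vec[OF E(2,1) skew_mats_carrier[OF Z]]
    by simp
  finally show ?thesis .
qed

text \<open>To be used with the squared entries of a symmetric or skew-symmetric matrix: each strict
  lower entry also stands for its mirror image and counts twice. The second form matches the squared
  weights of \<open>D_S\<close>, the first serves \<open>D_SK\<close>.\<close>

lemma sum_square_split:
  fixes f :: "nat \<times> nat \<Rightarrow> real"
  assumes "\<And>i j. i < k \<Longrightarrow> j < k \<Longrightarrow> f (i, j) = f (j, i)"
  shows "sum f ({..<k} \<times> {..<k}) = (\<Sum>i<k. f (i, i)) + 2 * sum f (set (vecSK_idx k))"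
    and "(\<Sum>ij\<in>set (vecS_idx k). (if fst ij = snd ij then 1 else 2) * f ij) =
      sum f ({..<k} \<times> {..<k})"
proof -
  let ?L = "set (vecSK_idx k)" and ?U = "prod.swap ` set (vecSK_idx k)"
    and ?D = "(\<lambda>i. (i, i)) ` {..<k}"
  have "{..<k} \<times> {..<k} = ?D \<union> (?L \<union> ?U)"
    by (auto simp: set_idx image_iff)
  moreover have "?L \<inter> ?U = {}" "?D \<inter> (?L \<union> ?U) = {}" by (auto simp: set_idx)
  ultimately have "sum f ({..<k} \<times> {..<k}) = sum f ?D + (sum f ?L + sum f ?U)"
    by (simp add: sum.union_disjoint)
  moreover have "sum f ?D = (\<Sum>i<k. f (i, i))"
    by (subst sum.reindex) (auto simp: inj_on_def)
  moreover have "sum f ?U = sum f ?L"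
    using assms by (subst sum.reindex) (auto simp: set_idx intro!: sum.cong)
  ultimately show 1: "sum f ({..<k} \<times> {..<k}) = (\<Sum>i<k. f (i, i)) + 2 * sum f ?L"
    by simp
  let ?g = "\<lambda>ij. (if fst ij = snd ij then 1 else 2) * f ij"
  have "set (vecS_idx k) = ?D \<union> ?L" "?D \<inter> ?L = {}"
    by (auto simp: set_idx image_iff)
  then have "sum ?g (set (vecS_idx k)) = sum ?g ?D + sum ?g ?L"
    by (simp add: sum.union_disjoint)
  also have "sum ?g ?D = (\<Sum>i<k. f (i, i))"
    by (subst sum.reindex) (auto simp: inj_on_def)
  also have "sum ?g ?L = 2 * sum f ?L"
    unfolding sum_distrib_left by (rule sum.cong) (auto simp: set_idx)
  finally show "sum ?g (set (vecS_idx k)) = sum f ({..<k} \<times> {..<k})"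
    using 1 by simp
qed

lemma frob_norm_nonneg [simp]: "0 \<le> frob_norm A"
  by (simp add: frob_norm_def sum_nonneg)

lemma D_S_norm:
  assumes Z: "Z \<in> sym_mats k"
  shows "vec_norm2 (D_S k *\<^sub>v vecS Z) = frob_norm Z"
proof -
  note c = sym_mats_carrier[OF Z]
  let ?f = "\<lambda>ij. (Z $$ ij)\<^sup>2"
  have "(vec_norm2 (D_S k *\<^sub>v vecS Z))\<^sup>2 = (\<Sum>t<length (vecS_idx k).
      (if fst (vecS_idx k ! t) = snd (vecS_idx k ! t) then 1 else 2) * ?f (vecS_idx k ! t))"
    unfolding D_S_conv mat_diag_mult_vec[OF vecS_carrier[OF c]] vec_norm2_sq
    using c by (intro sum.cong) (auto simp: vecS_def length_idx power_mult_distrib)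
  also have "\<dots> = sum ?f ({..<k} \<times> {..<k})"
    using sum_nth_distinct[OF distinct_idx(1), of "\<lambda>ij. (if fst ij = snd ij then 1 else 2) * ?f ij" k]
      sum_square_split(2)[of k ?f] sym_mats_index[OF Z] by simp
  also have "\<dots> = (frob_norm Z)\<^sup>2"
    using c by (simp add: frob_norm_sq_prod)
  finally show ?thesis by (simp add: power2_eq_iff_nonneg)
qed

lemma D_SK_norm:
  assumes Z: "Z \<in> skew_mats k"
  shows "vec_norm2 (D_SK k *\<^sub>v vecSK Z) = frob_norm Z"
proof -
  note c = skew_mats_carrier[OF Z]
  let ?f = "\<lambda>ij. (Z $$ ij)\<^sup>2"
  have "(vec_norm2 (D_SK k *\<^sub>v vecSK Z))\<^sup>2 = (\<Sum>t<length (vecSK_idx k). 2 * ?f (vecSK_idx k ! t))"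
    unfolding D_SK_conv mat_diag_mult_vec[OF vecSK_carrier[OF c]] vec_norm2_sq
    using c by (intro sum.cong) (auto simp: vecSK_def length_idx power_mult_distrib)
  also have "\<dots> = 2 * sum ?f (set (vecSK_idx k))"
    using sum_nth_distinct[OF distinct_idx(2), of ?f k] by (simp flip: sum_distrib_left)
  also have "\<dots> = sum ?f ({..<k} \<times> {..<k})"
  proof -
    have "?f (i, j) = ?f (j, i)" if "i < k" "j < k" for i j
      using skew_mats_index[OF Z that] by simp
    \<comment> \<open>Skew-symmetry clears the diagonal, so doubling the strict lower triangle
      accounts for the whole Frobenius norm.\<close>
    moreover have "Z $$ (i, i) = 0" if "i < k" for i
      using skew_mats_index[OF Z that that] by simp
    ultimately show ?thesis
      by (subst sum_square_split(1)) auto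
  qed
  also have "\<dots> = (frob_norm Z)\<^sup>2"
    using c by (simp add: frob_norm_sq_prod)
  finally show ?thesis by (simp add: power2_eq_iff_nonneg)
qed

lemma D_S_surj:
  assumes y: "y \<in> carrier_vec (k * (k + 1) div 2)"
  obtains Z where "Z \<in> sym_mats k" "D_S k *\<^sub>v vecS Z = y"
proof -
  let ?N = "k * (k + 1) div 2"
  \<comment> \<open>The diagonal weights of \<open>D_S\<close>; dividing by them undoes the
    scaling.\<close>
  let ?d = "\<lambda>t. if fst (vecS_idx k ! t) = snd (vecS_idx k ! t) then 1 else sqrt 2"
  have "vec ?N (\<lambda>t. y $ t / ?d t) \<in> carrier_vec (length (vecS_idx k))"
    by (simp add: length_idx)
  from entries_at_surj[OF distinct_idx(1) this] obtain f where
    f: "\<And>Z. (\<And>ij. ij \<in> set (vecS_idx k) \<Longrightarrow> Z $$ ij = f ij) \<Longrightarrow>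
      entries_at (vecS_idx k) Z = vec ?N (\<lambda>t. y $ t / ?d t)"
    by blast
  \<comment> \<open>Only the values of \<open>f\<close> on the lower triangle are controlled;
    \<open>max\<close> and \<open>min\<close> reflect every pair into it.\<close>
  define Z where "Z = mat k k (\<lambda>(i, j). f (max i j, min i j))"
  have Z: "Z \<in> sym_mats k"
    by (auto simp: sym_mats_def Z_def max.commute min.commute)
  have "entries_at (vecS_idx k) Z = vec ?N (\<lambda>t. y $ t / ?d t)"
    by (rule f) (auto simp: Z_def set_idx max_def min_def)
  then have "vecS Z = vec ?N (\<lambda>t. y $ t / ?d t)"
    by (simp add: vecS_def Z_def)
  then have "D_S k *\<^sub>v vecS Z = y"
    using y unfolding D_S_conv by (subst mat_diag_mult_vec) (auto intro!: eq_vecI)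
  with Z show thesis by (rule that)
qed

lemma D_SK_surj:
  assumes y: "y \<in> carrier_vec (k * (k - 1) div 2)"
  obtains Z where "Z \<in> skew_mats k" "D_SK k *\<^sub>v vecSK Z = y"
proof -
  let ?N = "k * (k - 1) div 2"
  have "vec ?N (\<lambda>t. y $ t / sqrt 2) \<in> carrier_vec (length (vecSK_idx k))"
    by (simp add: length_idx)
  from entries_at_surj[OF distinct_idx(2) this] obtain f where
    f: "\<And>Z. (\<And>ij. ij \<in> set (vecSK_idx k) \<Longrightarrow> Z $$ ij = f ij) \<Longrightarrow>
      entries_at (vecSK_idx k) Z = vec ?N (\<lambda>t. y $ t / sqrt 2)"
    by blast
  define Z where "Z = mat k k (\<lambda>(i, j). if j < i then f (i, j) else if i < j then - f (j, i) else 0)"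
  have Z: "Z \<in> skew_mats k"
    by (auto simp: skew_mats_def Z_def)
  have "entries_at (vecSK_idx k) Z = vec ?N (\<lambda>t. y $ t / sqrt 2)"
    by (rule f) (auto simp: Z_def set_idx)
  then have "vecSK Z = vec ?N (\<lambda>t. y $ t / sqrt 2)"
    by (simp add: vecSK_def Z_def)
  then have "D_SK k *\<^sub>v vecSK Z = y"
    using y unfolding D_SK_conv by (subst mat_diag_mult_vec) (auto intro!: eq_vecI)
  with Z show thesis by (rule that)
qed

section \<open>The rows of the coefficient matrix\<close>

lemma Re_mult_mat_vec:
  assumes "A \<in> carrier_mat k l" "x \<in> carrier_vec l"
  shows "map_vec Re (A *\<^sub>v x) = map_mat Re A *\<^sub>v map_vec Re x - map_mat Im A *\<^sub>v map_vec Im x"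
  using assms by (intro eq_vecI) (auto simp: scalar_prod_def sum_subtractf)

lemma Im_mult_mat_vec:
  assumes "A \<in> carrier_mat k l" "x \<in> carrier_vec l"
  shows "map_vec Im (A *\<^sub>v x) = map_mat Re A *\<^sub>v map_vec Im x + map_mat Im A *\<^sub>v map_vec Re x"
  using assms by (intro eq_vecI) (auto simp: scalar_prod_def sum.distrib)

lemma Re_Im_mat_adjoint:
  "map_mat Re (mat_adjoint A) = (map_mat Re A)\<^sup>T"
  "map_mat Im (mat_adjoint A) = - (map_mat Im A)\<^sup>T"
  by (rule eq_matI; simp)+

lemma Re_Im_hadamard_Theta:
  assumes "A \<in> carrier_mat k l" "X \<in> carrier_mat k l"
  shows "map_mat Re (A \<odot>\<^sub>m Theta X) = map_mat Re A \<odot>\<^sub>m Theta X"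
    "map_mat Im (A \<odot>\<^sub>m Theta X) = map_mat Im A \<odot>\<^sub>m Theta X"
  using assms by (auto intro!: eq_matI)

text \<open>The weight in a coordinate block cancels the inverse weight in the matrix block; the
  second form is for blocks that carry a minus sign.\<close>

lemma inverse_smult_mult_vec:
  fixes B :: "'a :: field mat"
  assumes "B \<in> carrier_mat k l" "y \<in> carrier_vec l" "a \<noteq> 0"
  shows "(inverse a \<cdot>\<^sub>m B) *\<^sub>v (a \<cdot>\<^sub>v y) = B *\<^sub>v y"
    "(- (inverse a \<cdot>\<^sub>m B)) *\<^sub>v (a \<cdot>\<^sub>v y) = - (B *\<^sub>v y)"
  using assms
  by (auto intro!: eq_vecI sum.cong simp: scalar_prod_def sum_negf[symmetric] field_simps simp del: sum_negf)

lemma kron_row_one_carrier [simp]: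
  "x \<in> carrier_vec l \<Longrightarrow> row_mat x \<otimes>\<^sub>k 1\<^sub>m k \<in> carrier_mat k (k * l)"
  "x \<in> carrier_vec l \<Longrightarrow> 1\<^sub>m k \<otimes>\<^sub>k row_mat x \<in> carrier_mat k (l * k)"
  by (auto intro!: carrier_matI simp: mult.commute)

lemma kron_N1:
  assumes E: "E \<in> carrier_mat k k" "hermitian_mat E" and x: "x \<in> carrier_vec k"
  shows "(row_mat x \<otimes>\<^sub>k 1\<^sub>m k) * N1 E \<in> carrier_mat k (k * (k + 1) div 2)"
    "Z \<in> sym_mats k \<Longrightarrow>
      ((row_mat x \<otimes>\<^sub>k 1\<^sub>m k) * N1 E) *\<^sub>v (D_S k *\<^sub>v vecS Z) = (Z \<odot>\<^sub>m Theta E) *\<^sub>v x"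
proof -
  note K = kron_row_one_carrier(1)[OF x, of k] and N = N1_carrier[OF E(1), unfolded power2_eq_square]
  show "(row_mat x \<otimes>\<^sub>k 1\<^sub>m k) * N1 E \<in> carrier_mat k (k * (k + 1) div 2)"
    using K N by (rule mult_carrier_mat)
  assume Z: "Z \<in> sym_mats k"
  note D = mult_mat_vec_carrier[OF D_S_carrier vecS_carrier[OF sym_mats_carrier[OF Z]]]
  show "((row_mat x \<otimes>\<^sub>k 1\<^sub>m k) * N1 E) *\<^sub>v (D_S k *\<^sub>v vecS Z) = (Z \<odot>\<^sub>m Theta E) *\<^sub>v x"
    unfolding assoc_mult_mat_vec[OF K N D] N1_mult_vec[OF E Z]
    by (rule kron_row_one_mult_vec[OF hadamard_dims(3)[OF sym_mats_carrier[OF Z]] x])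
qed

lemma kron_N2:
  assumes E: "E \<in> carrier_mat k k" "hermitian_mat E" and x: "x \<in> carrier_vec k"
  shows "(row_mat x \<otimes>\<^sub>k 1\<^sub>m k) * N2 E \<in> carrier_mat k (k * (k - 1) div 2)"
    "Z \<in> skew_mats k \<Longrightarrow>
      ((row_mat x \<otimes>\<^sub>k 1\<^sub>m k) * N2 E) *\<^sub>v (D_SK k *\<^sub>v vecSK Z) = (Z \<odot>\<^sub>m Theta E) *\<^sub>v x"
proof -
  note K = kron_row_one_carrier(1)[OF x, of k] and N = N2_carrier[OF E(1), unfolded power2_eq_square]
  show "(row_mat x \<otimes>\<^sub>k 1\<^sub>m k) * N2 E \<in> carrier_mat k (k * (k - 1) div 2)"
    using K N by (rule mult_carrier_mat)
  assume Z: "Z \<in> skew_mats k"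
  note D = mult_mat_vec_carrier[OF D_SK_carrier vecSK_carrier[OF skew_mats_carrier[OF Z]]]
  show "((row_mat x \<otimes>\<^sub>k 1\<^sub>m k) * N2 E) *\<^sub>v (D_SK k *\<^sub>v vecSK Z) = (Z \<odot>\<^sub>m Theta E) *\<^sub>v x"
    unfolding assoc_mult_mat_vec[OF K N D] N2_mult_vec[OF E Z]
    by (rule kron_row_one_mult_vec[OF hadamard_dims(3)[OF skew_mats_carrier[OF Z]] x])
qed

lemma kron_row_one_Sigma:
  assumes X: "X \<in> carrier_mat k l" and x: "x \<in> carrier_vec l"
  shows "(row_mat x \<otimes>\<^sub>k 1\<^sub>m k) * Sigma_mat X \<in> carrier_mat k (k * l)"
    "Z \<in> carrier_mat k l \<Longrightarrow>
      ((row_mat x \<otimes>\<^sub>k 1\<^sub>m k) * Sigma_mat X) *\<^sub>v vec_mat Z = (Z \<odot>\<^sub>m Theta X) *\<^sub>v x"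
proof -
  note K = kron_row_one_carrier(1)[OF x, of k] and N = Sigma_mat_carrier[OF X]
  show "(row_mat x \<otimes>\<^sub>k 1\<^sub>m k) * Sigma_mat X \<in> carrier_mat k (k * l)"
    using K N by (rule mult_carrier_mat)
  assume Z: "Z \<in> carrier_mat k l"
  show "((row_mat x \<otimes>\<^sub>k 1\<^sub>m k) * Sigma_mat X) *\<^sub>v vec_mat Z = (Z \<odot>\<^sub>m Theta X) *\<^sub>v x"
    unfolding assoc_mult_mat_vec[OF K N vec_mat_carrier[OF Z]] Sigma_mat_mult_vec[OF X Z]
    by (rule kron_row_one_mult_vec[OF hadamard_dims(3)[OF Z] x])
qed

lemma kron_one_row_Sigma:
  assumes X: "X \<in> carrier_mat l k" and x: "x \<in> carrier_vec l"
  shows "(1\<^sub>m k \<otimes>\<^sub>k row_mat x) * Sigma_mat X \<in> carrier_mat k (l * k)"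
    "Z \<in> carrier_mat l k \<Longrightarrow>
      ((1\<^sub>m k \<otimes>\<^sub>k row_mat x) * Sigma_mat X) *\<^sub>v vec_mat Z = (Z \<odot>\<^sub>m Theta X)\<^sup>T *\<^sub>v x"
proof -
  note K = kron_row_one_carrier(2)[OF x, of k] and N = Sigma_mat_carrier[OF X]
  show "(1\<^sub>m k \<otimes>\<^sub>k row_mat x) * Sigma_mat X \<in> carrier_mat k (l * k)"
    using K N by (rule mult_carrier_mat)
  assume Z: "Z \<in> carrier_mat l k"
  show "((1\<^sub>m k \<otimes>\<^sub>k row_mat x) * Sigma_mat X) *\<^sub>v vec_mat Z = (Z \<odot>\<^sub>m Theta X)\<^sup>T *\<^sub>v x"
    unfolding assoc_mult_mat_vec[OF K N vec_mat_carrier[OF Z]] Sigma_mat_mult_vec[OF X Z]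
    by (rule kron_one_row_mult_vec[OF hadamard_dims(3)[OF Z] x])
qed

text \<open>The common shape of \<open>X1_hat\<close> and \<open>X2_hat\<close>: the upper block row
  yields real parts, the lower one imaginary parts.\<close>

lemma
  fixes A1 :: "'a :: comm_ring_1 mat"
  assumes A: "A1 \<in> carrier_mat k s1" "A2 \<in> carrier_mat k s2" "A3 \<in> carrier_mat k s3" "A4 \<in> carrier_mat k s4"
    and B: "B1 \<in> carrier_mat k s1" "B2 \<in> carrier_mat k s2" "B3 \<in> carrier_mat k s3" "B4 \<in> carrier_mat k s4"
  shows two_by_four_carrier: "(A1 @\<^sub>c A2 @\<^sub>c A3 @\<^sub>c A4) @\<^sub>r (B1 @\<^sub>c B2 @\<^sub>c B3 @\<^sub>c B4)
      \<in> carrier_mat (2 * k) (s1 + (s2 + (s3 + s4)))"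
    and two_by_four_mult_vec: "\<lbrakk>y1 \<in> carrier_vec s1; y2 \<in> carrier_vec s2; y3 \<in> carrier_vec s3; y4 \<in> carrier_vec s4\<rbrakk> \<Longrightarrow>
      ((A1 @\<^sub>c A2 @\<^sub>c A3 @\<^sub>c A4) @\<^sub>r (B1 @\<^sub>c B2 @\<^sub>c B3 @\<^sub>c B4)) *\<^sub>v (y1 @\<^sub>v y2 @\<^sub>v y3 @\<^sub>v y4)
      = (A1 *\<^sub>v y1 + (A2 *\<^sub>v y2 + (A3 *\<^sub>v y3 + A4 *\<^sub>v y4)))
        @\<^sub>v (B1 *\<^sub>v y1 + (B2 *\<^sub>v y2 + (B3 *\<^sub>v y3 + B4 *\<^sub>v y4)))"
proof -
  let ?s = "s1 + (s2 + (s3 + s4))"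
  have cA: "A1 @\<^sub>c A2 @\<^sub>c A3 @\<^sub>c A4 \<in> carrier_mat k ?s" and cB: "B1 @\<^sub>c B2 @\<^sub>c B3 @\<^sub>c B4 \<in> carrier_mat k ?s"
    using A B by simp_all
  show "(A1 @\<^sub>c A2 @\<^sub>c A3 @\<^sub>c A4) @\<^sub>r (B1 @\<^sub>c B2 @\<^sub>c B3 @\<^sub>c B4) \<in> carrier_mat (2 * k) ?s"
    unfolding mult_2 using cA cB by (rule carrier_append_rows)
  have row: "(C1 @\<^sub>c C2 @\<^sub>c C3 @\<^sub>c C4) *\<^sub>v (y1 @\<^sub>v y2 @\<^sub>v y3 @\<^sub>v y4)
      = C1 *\<^sub>v y1 + (C2 *\<^sub>v y2 + (C3 *\<^sub>v y3 + C4 *\<^sub>v y4))"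
    if "y1 \<in> carrier_vec s1" "y2 \<in> carrier_vec s2" "y3 \<in> carrier_vec s3" "y4 \<in> carrier_vec s4"
      "C1 \<in> carrier_mat k s1" "C2 \<in> carrier_mat k s2" "C3 \<in> carrier_mat k s3" "C4 \<in> carrier_mat k s4"
    for C1 C2 C3 C4 :: "'a mat"
  proof -
    have "(C1 @\<^sub>c C2 @\<^sub>c C3 @\<^sub>c C4) *\<^sub>v (y1 @\<^sub>v y2 @\<^sub>v y3 @\<^sub>v y4)
        = C1 *\<^sub>v y1 + (C2 @\<^sub>c C3 @\<^sub>c C4) *\<^sub>v (y2 @\<^sub>v y3 @\<^sub>v y4)"
      using that by (intro append_cols_mult_vec[of _ k s1 _ "s2 + (s3 + s4)"]) simp_all
    also have "(C2 @\<^sub>c C3 @\<^sub>c C4) *\<^sub>v (y2 @\<^sub>v y3 @\<^sub>v y4) = C2 *\<^sub>v y2 + (C3 @\<^sub>c C4) *\<^sub>v (y3 @\<^sub>v y4)"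
      using that by (intro append_cols_mult_vec[of _ k s2 _ "s3 + s4"]) simp_all
    also have "(C3 @\<^sub>c C4) *\<^sub>v (y3 @\<^sub>v y4) = C3 *\<^sub>v y3 + C4 *\<^sub>v y4"
      using that by (intro append_cols_mult_vec) simp_all
    finally show ?thesis .
  qed
  assume y: "y1 \<in> carrier_vec s1" "y2 \<in> carrier_vec s2" "y3 \<in> carrier_vec s3" "y4 \<in> carrier_vec s4"
  then have y': "y1 @\<^sub>v y2 @\<^sub>v y3 @\<^sub>v y4 \<in> carrier_vec ?s" by simp
  show "((A1 @\<^sub>c A2 @\<^sub>c A3 @\<^sub>c A4) @\<^sub>r (B1 @\<^sub>c B2 @\<^sub>c B3 @\<^sub>c B4)) *\<^sub>v (y1 @\<^sub>v y2 @\<^sub>v y3 @\<^sub>v y4)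
      = (A1 *\<^sub>v y1 + (A2 *\<^sub>v y2 + (A3 *\<^sub>v y3 + A4 *\<^sub>v y4)))
        @\<^sub>v (B1 *\<^sub>v y1 + (B2 *\<^sub>v y2 + (B3 *\<^sub>v y3 + B4 *\<^sub>v y4)))"
    unfolding mat_mult_append[OF cA cB y'] row[OF y A] row[OF y B] ..
qed

text \<open>The isometric identification of a complex space with a real space of twice the
  dimension.\<close>

definition re_im :: "complex vec \<Rightarrow> real vec" where
  "re_im v = map_vec Re v @\<^sub>v map_vec Im v"

lemma re_im_carrier [simp]: "v \<in> carrier_vec k \<Longrightarrow> re_im v \<in> carrier_vec (2 * k)"
  unfolding mult_2 by (simp add: re_im_def)

lemma re_im_diff:
  "a \<in> carrier_vec k \<Longrightarrow> b \<in> carrier_vec k \<Longrightarrow> re_im a - re_im b = re_im (a - b)"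
  by (intro eq_vecI) (auto simp: re_im_def)

lemma re_im_inject:
  assumes "a \<in> carrier_vec k" "b \<in> carrier_vec k"
  shows "re_im a = re_im b \<longleftrightarrow> a = b"
proof
  assume "re_im a = re_im b"
  then have "map_vec Re a = map_vec Re b" "map_vec Im a = map_vec Im b"
    using assms append_vec_eq[of "map_vec Re a" k "map_vec Re b"] by (auto simp: re_im_def)
  then have "Re (a $ i) = Re (b $ i)" "Im (a $ i) = Im (b $ i)" if "i < k" for i
    using that assms by (metis carrier_vecD index_map_vec(1))+
  then show "a = b"
    using assms by (intro eq_vecI) (auto simp: complex_eq_iff)
qed simp

lemma vec_norm2_re_im: "vec_norm2 (re_im v) = vec_norm2 v"
proof -
  have "(vec_norm2 (re_im v))\<^sup>2 = (vec_norm2 v)\<^sup>2"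
    unfolding re_im_def vec_norm2_append vec_norm2_Re_Im[of v] ..
  then show ?thesis by (simp add: power2_eq_iff_nonneg)
qed

lemma re_im_surj:
  assumes "y \<in> carrier_vec (2 * k)"
  obtains v where "v \<in> carrier_vec k" "re_im v = y"
proof
  let ?v = "vec k (\<lambda>i. Complex (y $ i) (y $ (k + i)))"
  show "?v \<in> carrier_vec k" by simp
  show "re_im ?v = y" using assms by (intro eq_vecI) (auto simp: re_im_def)
qed

section \<open>The two coefficient blocks acting on coordinates\<close>

lemma X1_hat_carrier:
  assumes "E \<in> carrier_mat n n" "hermitian_mat E" "F \<in> carrier_mat m n"
    and "u \<in> carrier_vec n" "p \<in> carrier_vec m"
  shows "X1_hat n \<alpha>1 \<alpha>2 E F u p
    \<in> carrier_mat (2 * n) (n * (n + 1) div 2 + (n * (n - 1) div 2 + (m * n + m * n)))"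
  unfolding X1_hat_def Let_def
  using assms by (intro two_by_four_carrier smult_carrier_mat uminus_carrier_mat kron_N1 kron_N2
      kron_one_row_Sigma) simp_all

lemma X2_hat_carrier:
  assumes "F \<in> carrier_mat m n" "G \<in> carrier_mat m m"
    and "u \<in> carrier_vec n" "p \<in> carrier_vec m"
  shows "X2_hat m \<alpha>2 \<alpha>3 F G u p
    \<in> carrier_mat (2 * m) (m * n + (m * n + (m * m + m * m)))"
  unfolding X2_hat_def Let_def
  using assms by (intro two_by_four_carrier smult_carrier_mat uminus_carrier_mat 
      kron_row_one_Sigma) simp_all

text \<open>The first block equation in real form. The \<open>dE\<close> columns carry the signs of
  complex multiplication; the adjoint conjugates \<open>dF\<close>, so the terms with its imaginary
  part have the opposite sign.\<close>

lemma X1_hat_mult_vec: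
  assumes E: "E \<in> carrier_mat n n" "hermitian_mat E" and F: "F \<in> carrier_mat m n"
    and u: "u \<in> carrier_vec n" and p: "p \<in> carrier_vec m"
    and dE: "dE \<in> carrier_mat n n" "hermitian_mat dE" and dF: "dF \<in> carrier_mat m n"
    and pos: "\<alpha>1 > 0" "\<alpha>2 > 0"
  shows "X1_hat n \<alpha>1 \<alpha>2 E F u p *\<^sub>v
      (\<alpha>1 \<cdot>\<^sub>v (D_S n *\<^sub>v vecS (map_mat Re dE)) @\<^sub>v \<alpha>1 \<cdot>\<^sub>v (D_SK n *\<^sub>v vecSK (map_mat Im dE)) @\<^sub>v
       \<alpha>2 \<cdot>\<^sub>v vec_mat (map_mat Re dF) @\<^sub>v \<alpha>2 \<cdot>\<^sub>v vec_mat (map_mat Im dF))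
    = re_im ((dE \<odot>\<^sub>m Theta E) *\<^sub>v u + mat_adjoint (dF \<odot>\<^sub>m Theta F) *\<^sub>v p)"
proof -
  let ?ur = "map_vec Re u" and ?ui = "map_vec Im u" and ?pr = "map_vec Re p" and ?pi = "map_vec Im p"
  let ?N1 = "n * (n + 1) div 2" and ?N2 = "n * (n - 1) div 2"
  let ?A = "dE \<odot>\<^sub>m Theta E" and ?B = "dF \<odot>\<^sub>m Theta F"
  note sym = hermitian_Re_Im[OF dE(2,1)]
  have v: "D_S n *\<^sub>v vecS (map_mat Re dE) \<in> carrier_vec ?N1"
    "D_SK n *\<^sub>v vecSK (map_mat Im dE) \<in> carrier_vec ?N2"
    "vec_mat (map_mat Re dF) \<in> carrier_vec (m * n)" "vec_mat (map_mat Im dF) \<in> carrier_vec (m * n)"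
    using dE dF mult_mat_vec_carrier[OF D_S_carrier vecS_carrier[OF sym_mats_carrier[OF sym(1)]]]
      mult_mat_vec_carrier[OF D_SK_carrier vecSK_carrier[OF skew_mats_carrier[OF sym(2)]]]
    by (simp_all only: map_carrier_mat vec_mat_carrier)
  have x: "?ur \<in> carrier_vec n" "?ui \<in> carrier_vec n" "?pr \<in> carrier_vec m" "?pi \<in> carrier_vec m"
    using u p by simp_all
  \<comment> \<open>These facts alternate between the size of a block and its action; the
    odd-numbered ones feed the cancellation of weights below.\<close>
  note k = kron_N1[OF E x(1)] kron_N1[OF E x(2)] kron_N2[OF E x(1)] kron_N2[OF E x(2)]
    kron_one_row_Sigma[OF F x(3)] kron_one_row_Sigma[OF F x(4)]
  have A: "?A \<in> carrier_mat n n" and B: "?B \<in> carrier_mat m n"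
    and B': "mat_adjoint ?B \<in> carrier_mat n m"
    using dE dF by (auto intro!: carrier_matI)
  have c: "map_mat Re dF \<in> carrier_mat m n" "map_mat Im dF \<in> carrier_mat m n" using dF by simp_all
  have "X1_hat n \<alpha>1 \<alpha>2 E F u p *\<^sub>v
      (\<alpha>1 \<cdot>\<^sub>v (D_S n *\<^sub>v vecS (map_mat Re dE)) @\<^sub>v \<alpha>1 \<cdot>\<^sub>v (D_SK n *\<^sub>v vecSK (map_mat Im dE)) @\<^sub>v
       \<alpha>2 \<cdot>\<^sub>v vec_mat (map_mat Re dF) @\<^sub>v \<alpha>2 \<cdot>\<^sub>v vec_mat (map_mat Im dF))
    = (map_mat Re ?A *\<^sub>v ?ur + (- (map_mat Im ?A *\<^sub>v ?ui)
        + ((map_mat Re ?B)\<^sup>T *\<^sub>v ?pr + (map_mat Im ?B)\<^sup>T *\<^sub>v ?pi)))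
      @\<^sub>v (map_mat Re ?A *\<^sub>v ?ui + (map_mat Im ?A *\<^sub>v ?ur
        + ((map_mat Re ?B)\<^sup>T *\<^sub>v ?pi + - ((map_mat Im ?B)\<^sup>T *\<^sub>v ?pr))))"
    unfolding X1_hat_def Let_def
    using v k pos sym c Re_Im_hadamard_Theta[OF dE(1) E(1)] Re_Im_hadamard_Theta[OF dF F]
    by (subst two_by_four_mult_vec[of _ n ?N1 _ ?N2 _ "m * n" _ "m * n"])
      (simp_all add: inverse_smult_mult_vec[OF k(1)] inverse_smult_mult_vec[OF k(3)]
        inverse_smult_mult_vec[OF k(5)] inverse_smult_mult_vec[OF k(7)]
        inverse_smult_mult_vec[OF k(9)] inverse_smult_mult_vec[OF k(11)])
  also have "\<dots> = re_im (?A *\<^sub>v u + mat_adjoint ?B *\<^sub>v p)"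
  proof -
    have Re: "map_vec Re (?A *\<^sub>v u + mat_adjoint ?B *\<^sub>v p)
        = map_vec Re (?A *\<^sub>v u) + map_vec Re (mat_adjoint ?B *\<^sub>v p)"
      "map_vec Im (?A *\<^sub>v u + mat_adjoint ?B *\<^sub>v p)
        = map_vec Im (?A *\<^sub>v u) + map_vec Im (mat_adjoint ?B *\<^sub>v p)"
      using dE dF by (auto intro!: eq_vecI)
    show ?thesis
      unfolding re_im_def Re Re_mult_mat_vec[OF A u] Re_mult_mat_vec[OF B' p]
        Im_mult_mat_vec[OF A u] Im_mult_mat_vec[OF B' p] Re_Im_mat_adjoint
      using dE dF x by (intro arg_cong2[of _ _ _ _ append_vec]) (auto intro!: eq_vecI)
  qed
  finally show ?thesis .
qed

text \<open>The second block equation, where \<open>dF\<close> and \<open>dG\<close> both act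
  without conjugation. The \<open>dF\<close> coordinates are the same as in the first equation and
  couple the two.\<close>

lemma X2_hat_mult_vec:
  assumes F: "F \<in> carrier_mat m n" and G: "G \<in> carrier_mat m m"
    and u: "u \<in> carrier_vec n" and p: "p \<in> carrier_vec m"
    and dF: "dF \<in> carrier_mat m n" and dG: "dG \<in> carrier_mat m m"
    and pos: "\<alpha>2 > 0" "\<alpha>3 > 0"
  shows "X2_hat m \<alpha>2 \<alpha>3 F G u p *\<^sub>v
      (\<alpha>2 \<cdot>\<^sub>v vec_mat (map_mat Re dF) @\<^sub>v \<alpha>2 \<cdot>\<^sub>v vec_mat (map_mat Im dF) @\<^sub>v
       \<alpha>3 \<cdot>\<^sub>v vec_mat (map_mat Re dG) @\<^sub>v \<alpha>3 \<cdot>\<^sub>v vec_mat (map_mat Im dG))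
    = re_im ((dF \<odot>\<^sub>m Theta F) *\<^sub>v u + (dG \<odot>\<^sub>m Theta G) *\<^sub>v p)"
proof -
  let ?ur = "map_vec Re u" and ?ui = "map_vec Im u" and ?pr = "map_vec Re p" and ?pi = "map_vec Im p"
  let ?A = "dF \<odot>\<^sub>m Theta F" and ?B = "dG \<odot>\<^sub>m Theta G"
  have c: "map_mat Re dF \<in> carrier_mat m n" "map_mat Im dF \<in> carrier_mat m n"
    "map_mat Re dG \<in> carrier_mat m m" "map_mat Im dG \<in> carrier_mat m m"
    using dF dG by simp_all
  note v = c[THEN vec_mat_carrier]
  have x: "?ur \<in> carrier_vec n" "?ui \<in> carrier_vec n" "?pr \<in> carrier_vec m" "?pi \<in> carrier_vec m"
    using u p by simp_all
  note k = kron_row_one_Sigma[OF F x(1)] kron_row_one_Sigma[OF F x(2)]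
    kron_row_one_Sigma[OF G x(3)] kron_row_one_Sigma[OF G x(4)]
  have A: "?A \<in> carrier_mat m n" and B: "?B \<in> carrier_mat m m"
    using dF dG by (auto intro!: carrier_matI)
  have "X2_hat m \<alpha>2 \<alpha>3 F G u p *\<^sub>v
      (\<alpha>2 \<cdot>\<^sub>v vec_mat (map_mat Re dF) @\<^sub>v \<alpha>2 \<cdot>\<^sub>v vec_mat (map_mat Im dF) @\<^sub>v
       \<alpha>3 \<cdot>\<^sub>v vec_mat (map_mat Re dG) @\<^sub>v \<alpha>3 \<cdot>\<^sub>v vec_mat (map_mat Im dG))
    = (map_mat Re ?A *\<^sub>v ?ur + (- (map_mat Im ?A *\<^sub>v ?ui)
        + (map_mat Re ?B *\<^sub>v ?pr + - (map_mat Im ?B *\<^sub>v ?pi))))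
      @\<^sub>v (map_mat Re ?A *\<^sub>v ?ui + (map_mat Im ?A *\<^sub>v ?ur
        + (map_mat Re ?B *\<^sub>v ?pi + map_mat Im ?B *\<^sub>v ?pr)))"
    unfolding X2_hat_def Let_def
    using v k pos c Re_Im_hadamard_Theta[OF dF F] Re_Im_hadamard_Theta[OF dG G]
    by (subst two_by_four_mult_vec[of _ m "m * n" _ "m * n" _ "m * m" _ "m * m"])
      (simp_all add: inverse_smult_mult_vec[OF k(1)] inverse_smult_mult_vec[OF k(3)]
        inverse_smult_mult_vec[OF k(5)] inverse_smult_mult_vec[OF k(7)])
  also have "\<dots> = re_im (?A *\<^sub>v u + ?B *\<^sub>v p)"
  proof -
    have Re: "map_vec Re (?A *\<^sub>v u + ?B *\<^sub>v p) = map_vec Re (?A *\<^sub>v u) + map_vec Re (?B *\<^sub>v p)"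
      "map_vec Im (?A *\<^sub>v u + ?B *\<^sub>v p) = map_vec Im (?A *\<^sub>v u) + map_vec Im (?B *\<^sub>v p)"
      using dF dG by (auto intro!: eq_vecI)
    show ?thesis
      unfolding re_im_def Re Re_mult_mat_vec[OF A u] Re_mult_mat_vec[OF B p]
        Im_mult_mat_vec[OF A u] Im_mult_mat_vec[OF B p]
      using dF dG x by (intro arg_cong2[of _ _ _ _ append_vec]) (auto intro!: eq_vecI)
  qed
  finally show ?thesis .
qed

section \<open>Weighted coordinates of perturbations\<close>

text \<open>The scalings by \<open>D_S\<close> and \<open>D_SK\<close> compensate for each off-diagonal entry of \<open>\<Delta>E\<close> being
  listed once but counted twice by the Frobenius norm.\<close>

fun coords :: "nat \<Rightarrow> real \<Rightarrow> real \<Rightarrow> real \<Rightarrow> real \<Rightarrow> real \<Rightarrow> pert \<Rightarrow> real vec" where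
  "coords n \<alpha>1 \<alpha>2 \<alpha>3 \<beta>1 \<beta>2 (dE, dF, dG, dq, dr) =
    (\<alpha>1 \<cdot>\<^sub>v (D_S n *\<^sub>v vecS (map_mat Re dE)) @\<^sub>v \<alpha>1 \<cdot>\<^sub>v (D_SK n *\<^sub>v vecSK (map_mat Im dE)) @\<^sub>v
     \<alpha>2 \<cdot>\<^sub>v vec_mat (map_mat Re dF) @\<^sub>v \<alpha>2 \<cdot>\<^sub>v vec_mat (map_mat Im dF) @\<^sub>v
     \<alpha>3 \<cdot>\<^sub>v vec_mat (map_mat Re dG) @\<^sub>v \<alpha>3 \<cdot>\<^sub>v vec_mat (map_mat Im dG))
    @\<^sub>v (\<beta>1 \<cdot>\<^sub>v re_im dq @\<^sub>v \<beta>2 \<cdot>\<^sub>v re_im dr)"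

text \<open>Kept as an unevaluated sum, bracketed like the appended blocks of \<open>coords\<close>,
  so that carrier facts compose without arithmetic.\<close>

definition coords_dim :: "nat \<Rightarrow> nat \<Rightarrow> nat" where
  "coords_dim n m = n * (n + 1) div 2 + (n * (n - 1) div 2 + (m * n + (m * n + (m * m + m * m))))
    + (2 * n + 2 * m)"

text \<open>The domain on which \<open>coords\<close> loses nothing: \<open>vecS\<close> and
  \<open>vecSK\<close> read only a lower triangle, which determines a Hermitian
  \<open>dE\<close>.\<close>

definition herm_perts :: "nat \<Rightarrow> nat \<Rightarrow> pert set" where
  "herm_perts n m = {(dE, dF, dG, dq, dr) \<in> perts n m. hermitian_mat dE}"

text \<open>Squared norms add over appended blocks, and each Frobenius norm splits into those of the
  real and imaginary parts. For Hermitian \<open>dE\<close> these parts are symmetric and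
  skew-symmetric, where the weighted vectorizations are isometric.\<close>

lemma zeta_coords:
  assumes "t \<in> herm_perts n m"
  shows "vec_norm2 (coords n \<alpha>1 \<alpha>2 \<alpha>3 \<beta>1 \<beta>2 t) = zeta \<alpha>1 \<alpha>2 \<alpha>3 \<beta>1 \<beta>2 t"
proof -
  obtain dE dF dG dq dr where t: "t = (dE, dF, dG, dq, dr)" by (cases t)
  have dE: "hermitian_mat dE" "dE \<in> carrier_mat n n"
    using assms by (auto simp: t herm_perts_def perts_def)
  have "(vec_norm2 (coords n \<alpha>1 \<alpha>2 \<alpha>3 \<beta>1 \<beta>2 t))\<^sup>2 = \<alpha>1\<^sup>2 * (frob_norm dE)\<^sup>2 + \<alpha>2\<^sup>2 * (frob_norm dF)\<^sup>2
      + \<alpha>3\<^sup>2 * (frob_norm dG)\<^sup>2 + \<beta>1\<^sup>2 * (vec_norm2 dq)\<^sup>2 + \<beta>2\<^sup>2 * (vec_norm2 dr)\<^sup>2"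
    unfolding t coords.simps vec_norm2_append vec_norm2_smult power_mult_distrib
      D_S_norm[OF hermitian_Re_Im(1)[OF dE]] D_SK_norm[OF hermitian_Re_Im(2)[OF dE]]
      vec_mat_norm vec_norm2_re_im
    by (simp add: frob_norm_Re_Im[of dE] frob_norm_Re_Im[of dF] frob_norm_Re_Im[of dG] algebra_simps)
  then show ?thesis
    by (simp add: t real_sqrt_unique)
qed

section \<open>Realizing every real vector by a perturbation\<close>

lemma append_vec_surj:
  assumes "y \<in> carrier_vec (k + l)"
  obtains a b where "a \<in> carrier_vec k" "b \<in> carrier_vec l" "y = a @\<^sub>v b"
proof
  show "vec_first y k \<in> carrier_vec k" "vec_last y l \<in> carrier_vec l" by simp_all
  show "y = vec_first y k @\<^sub>v vec_last y l" using assms by simp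
qed

lemma smult_vec_surj:
  fixes y :: "'a :: field vec"
  assumes "y \<in> carrier_vec k" "c \<noteq> 0"
  obtains z where "z \<in> carrier_vec k" "y = c \<cdot>\<^sub>v z"
  using that[of "inverse c \<cdot>\<^sub>v y"] assms by (auto simp: smult_smult_assoc)

lemma Re_Im_mat_surj:
  assumes "A \<in> carrier_mat k l" "B \<in> carrier_mat k l"
  obtains Z where "Z \<in> carrier_mat k l" "map_mat Re Z = A" "map_mat Im Z = B"
proof
  let ?Z = "mat k l (\<lambda>ij. Complex (A $$ ij) (B $$ ij))"
  show "?Z \<in> carrier_mat k l" "map_mat Re ?Z = A" "map_mat Im ?Z = B"
    using assms by (auto intro!: eq_matI)
qed

lemma weighted_mat_surj:
  assumes "y1 \<in> carrier_vec (k * l)" "y2 \<in> carrier_vec (k * l)" "c \<noteq> 0"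
  obtains Z where "Z \<in> carrier_mat k l" "y1 = c \<cdot>\<^sub>v vec_mat (map_mat Re Z)"
    "y2 = c \<cdot>\<^sub>v vec_mat (map_mat Im Z)"
proof -
  obtain z1 z2 where "z1 \<in> carrier_vec (k * l)" "y1 = c \<cdot>\<^sub>v z1" "z2 \<in> carrier_vec (k * l)" "y2 = c \<cdot>\<^sub>v z2"
    using assms smult_vec_surj by metis
  moreover obtain A B where "A \<in> carrier_mat k l" "vec_mat A = z1" "B \<in> carrier_mat k l" "vec_mat B = z2"
    using calculation vec_mat_surj by metis
  moreover obtain Z where "Z \<in> carrier_mat k l" "map_mat Re Z = A" "map_mat Im Z = B"
    using calculation Re_Im_mat_surj by metis
  ultimately show thesis using that by metis
qed

lemma weighted_re_im_surj:
  assumes "y \<in> carrier_vec (2 * k)" "c \<noteq> 0"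
  obtains v where "v \<in> carrier_vec k" "y = c \<cdot>\<^sub>v re_im v"
  using assms smult_vec_surj re_im_surj by metis

text \<open>A symmetric real part and a skew-symmetric imaginary part can be prescribed
  independently, and together they always form a Hermitian matrix.\<close>

lemma weighted_hermitian_surj:
  assumes "y1 \<in> carrier_vec (k * (k + 1) div 2)" "y2 \<in> carrier_vec (k * (k - 1) div 2)" "c \<noteq> 0"
  obtains A where "A \<in> carrier_mat k k" "hermitian_mat A"
    "y1 = c \<cdot>\<^sub>v (D_S k *\<^sub>v vecS (map_mat Re A))" "y2 = c \<cdot>\<^sub>v (D_SK k *\<^sub>v vecSK (map_mat Im A))"
proof -
  obtain z1 where z1: "z1 \<in> carrier_vec (k * (k + 1) div 2)" "y1 = c \<cdot>\<^sub>v z1"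
    using smult_vec_surj[OF assms(1,3)] .
  obtain z2 where z2: "z2 \<in> carrier_vec (k * (k - 1) div 2)" "y2 = c \<cdot>\<^sub>v z2"
    using smult_vec_surj[OF assms(2,3)] .
  obtain S where S: "S \<in> sym_mats k" "D_S k *\<^sub>v vecS S = z1"
    using D_S_surj[OF z1(1)] .
  obtain K where K: "K \<in> skew_mats k" "D_SK k *\<^sub>v vecSK K = z2"
    using D_SK_surj[OF z2(1)] .
  obtain A where A: "A \<in> carrier_mat k k" "map_mat Re A = S" "map_mat Im A = K"
    using Re_Im_mat_surj[OF sym_mats_carrier[OF S(1)] skew_mats_carrier[OF K(1)]] .
  have "hermitian_mat A"
  proof (rule hermitian_matI[OF A(1)])
    fix i j assume ij: "i < k" "j < k"
    then have "Re (A $$ (i, j)) = Re (A $$ (j, i))" "Im (A $$ (i, j)) = - Im (A $$ (j, i))"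
      using sym_mats_index[OF S(1) ij] skew_mats_index[OF K(1) ij] A(1) by (auto simp flip: A(2,3))
    then show "A $$ (i, j) = cnj (A $$ (j, i))" by (simp add: complex_eq_iff)
  qed
  then show thesis
    by (rule that[OF A(1)]) (simp_all only: A(2,3) S(2) z1(2) K(2) z2(2))
qed

text \<open>Guarantees that the shortest solution of the real system comes from an actual
  perturbation. Positive weights allow each block to be unscaled.\<close>

lemma coords_surj:
  assumes y: "y \<in> carrier_vec (coords_dim n m)"
    and pos: "\<alpha>1 > 0" "\<alpha>2 > 0" "\<alpha>3 > 0" "\<beta>1 > 0" "\<beta>2 > 0"
  obtains t where "t \<in> herm_perts n m" "coords n \<alpha>1 \<alpha>2 \<alpha>3 \<beta>1 \<beta>2 t = y"
proof -
  obtain x s where xs: "x \<in> carrier_vec (n * (n + 1) div 2 + (n * (n - 1) div 2 + (m * n + (m * n + (m * m + m * m)))))"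
    "s \<in> carrier_vec (2 * n + 2 * m)" "y = x @\<^sub>v s"
    using append_vec_surj[OF y[unfolded coords_dim_def]] .
  obtain y1 x1 where 1: "y1 \<in> carrier_vec (n * (n + 1) div 2)"
    "x1 \<in> carrier_vec (n * (n - 1) div 2 + (m * n + (m * n + (m * m + m * m))))" "x = y1 @\<^sub>v x1"
    using append_vec_surj[OF xs(1)] .
  obtain y2 x2 where 2: "y2 \<in> carrier_vec (n * (n - 1) div 2)"
    "x2 \<in> carrier_vec (m * n + (m * n + (m * m + m * m)))" "x1 = y2 @\<^sub>v x2"
    using append_vec_surj[OF 1(2)] .
  obtain y3 x3 where 3: "y3 \<in> carrier_vec (m * n)"
    "x3 \<in> carrier_vec (m * n + (m * m + m * m))" "x2 = y3 @\<^sub>v x3"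
    using append_vec_surj[OF 2(2)] .
  obtain y4 x4 where 4: "y4 \<in> carrier_vec (m * n)"
    "x4 \<in> carrier_vec (m * m + m * m)" "x3 = y4 @\<^sub>v x4"
    using append_vec_surj[OF 3(2)] .
  obtain y5 y6 where 5: "y5 \<in> carrier_vec (m * m)" "y6 \<in> carrier_vec (m * m)" "x4 = y5 @\<^sub>v y6"
    using append_vec_surj[OF 4(2)] .
  obtain y7 y8 where 7: "y7 \<in> carrier_vec (2 * n)" "y8 \<in> carrier_vec (2 * m)" "s = y7 @\<^sub>v y8"
    using append_vec_surj[OF xs(2)] .
  have nz: "\<alpha>1 \<noteq> 0" "\<alpha>2 \<noteq> 0" "\<alpha>3 \<noteq> 0" "\<beta>1 \<noteq> 0" "\<beta>2 \<noteq> 0" using pos by simp_all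
  obtain dE where dE: "dE \<in> carrier_mat n n" "hermitian_mat dE"
    "y1 = \<alpha>1 \<cdot>\<^sub>v (D_S n *\<^sub>v vecS (map_mat Re dE))" "y2 = \<alpha>1 \<cdot>\<^sub>v (D_SK n *\<^sub>v vecSK (map_mat Im dE))"
    using weighted_hermitian_surj[OF 1(1) 2(1) nz(1)] .
  obtain dF where dF: "dF \<in> carrier_mat m n" "y3 = \<alpha>2 \<cdot>\<^sub>v vec_mat (map_mat Re dF)"
    "y4 = \<alpha>2 \<cdot>\<^sub>v vec_mat (map_mat Im dF)"
    using weighted_mat_surj[OF 3(1) 4(1) nz(2)] .
  obtain dG where dG: "dG \<in> carrier_mat m m" "y5 = \<alpha>3 \<cdot>\<^sub>v vec_mat (map_mat Re dG)"
    "y6 = \<alpha>3 \<cdot>\<^sub>v vec_mat (map_mat Im dG)"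
    using weighted_mat_surj[OF 5(1,2) nz(3)] .
  obtain dq where dq: "dq \<in> carrier_vec n" "y7 = \<beta>1 \<cdot>\<^sub>v re_im dq"
    using weighted_re_im_surj[OF 7(1) nz(4)] .
  obtain dr where dr: "dr \<in> carrier_vec m" "y8 = \<beta>2 \<cdot>\<^sub>v re_im dr"
    using weighted_re_im_surj[OF 7(2) nz(5)] .
  show thesis
  proof (rule that)
    show "(dE, dF, dG, dq, dr) \<in> herm_perts n m"
      using dE dF dG dq dr by (simp add: herm_perts_def perts_def)
    show "coords n \<alpha>1 \<alpha>2 \<alpha>3 \<beta>1 \<beta>2 (dE, dF, dG, dq, dr) = y"
      by (simp only: coords.simps xs(3) 1(3) 2(3) 3(3) 4(3) 5(3) 7(3) dE dF dG dq dr)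
  qed
qed

lemma coords_carrier:
  assumes "t \<in> herm_perts n m"
  shows "coords n \<alpha>1 \<alpha>2 \<alpha>3 \<beta>1 \<beta>2 t \<in> carrier_vec (coords_dim n m)"
proof -
  obtain dE dF dG dq dr where t: "t = (dE, dF, dG, dq, dr)" by (cases t)
  have c: "dE \<in> carrier_mat n n" "dF \<in> carrier_mat m n" "dG \<in> carrier_mat m m"
    "dq \<in> carrier_vec n" "dr \<in> carrier_vec m"
    using assms by (auto simp: t herm_perts_def perts_def)
  show ?thesis
    unfolding t coords.simps coords_dim_def
    by (intro append_carrier_vec smult_carrier_vec[THEN iffD2] mult_mat_vec_carrier[OF D_S_carrier]
        mult_mat_vec_carrier[OF D_SK_carrier] vecS_carrier vecSK_carrier vec_mat_carrier re_im_carrier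
        map_carrier_mat[THEN iffD2] c)
qed

section \<open>The coefficient matrix\<close>

text \<open>The block matrix of the closed formula, called \<open>M\<close> in the theorem.\<close>

definition backward_mat :: "nat \<Rightarrow> nat \<Rightarrow> real \<Rightarrow> real \<Rightarrow> real \<Rightarrow> real \<Rightarrow> real \<Rightarrow> complex mat
    \<Rightarrow> complex mat \<Rightarrow> complex mat \<Rightarrow> complex vec \<Rightarrow> complex vec \<Rightarrow> real mat" where
  "backward_mat n m \<alpha>1 \<alpha>2 \<alpha>3 \<beta>1 \<beta>2 E F G u p = four_block_mat
    (X1_hat n \<alpha>1 \<alpha>2 E F u p @\<^sub>c 0\<^sub>m (2 * n) (2 * m\<^sup>2))
    ((- (inverse \<beta>1 \<cdot>\<^sub>m 1\<^sub>m (2 * n))) @\<^sub>c 0\<^sub>m (2 * n) (2 * m))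
    (0\<^sub>m (2 * m) (n\<^sup>2) @\<^sub>c X2_hat m \<alpha>2 \<alpha>3 F G u p)
    (0\<^sub>m (2 * m) (2 * n) @\<^sub>c (- (inverse \<beta>2 \<cdot>\<^sub>m 1\<^sub>m (2 * m))))"

text \<open>Reconciles the \<open>n\<^sup>2\<close> zero columns in front of \<open>X2_hat\<close>
  with the separate symmetric and skew-symmetric coordinates of \<open>dE\<close>.\<close>

lemma triangle_numbers_add: "k * (k + 1) div 2 + k * (k - 1) div 2 = k\<^sup>2" for k :: nat
proof -
  have "even (k * (k + 1))" "even (k * (k - 1))" by (cases k; simp)+
  then have "2 * (k * (k + 1) div 2 + k * (k - 1) div 2) = k * (k + 1) + k * (k - 1)"
    unfolding distrib_left by (simp only: dvd_mult_div_cancel)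
  also have "\<dots> = 2 * k\<^sup>2" by (cases k) (simp_all add: power2_eq_square)
  finally show ?thesis by simp
qed

text \<open>The image of a coordinate vector collects what the masked perturbation adds to the
  left-hand sides of the two block equations, minus the change of the right-hand sides. Feasibility
  will mean that it equals the residuals \<open>Q\<close> and \<open>R\<close>.\<close>

lemma
  fixes n m :: nat
  assumes E: "E \<in> carrier_mat n n" "hermitian_mat E" and F: "F \<in> carrier_mat m n"
    and G: "G \<in> carrier_mat m m" and u: "u \<in> carrier_vec n" and p: "p \<in> carrier_vec m"
  shows backward_mat_carrier:
      "backward_mat n m \<alpha>1 \<alpha>2 \<alpha>3 \<beta>1 \<beta>2 E F G u p \<in> carrier_mat (2 * n + 2 * m) (coords_dim n m)"
    and backward_mat_mult_coords:
      "\<lbrakk>\<alpha>1 > 0; \<alpha>2 > 0; \<alpha>3 > 0; \<beta>1 > 0; \<beta>2 > 0; (dE, dF, dG, dq, dr) \<in> herm_perts n m\<rbrakk> \<Longrightarrow>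
        backward_mat n m \<alpha>1 \<alpha>2 \<alpha>3 \<beta>1 \<beta>2 E F G u p *\<^sub>v coords n \<alpha>1 \<alpha>2 \<alpha>3 \<beta>1 \<beta>2 (dE, dF, dG, dq, dr)
        = re_im ((dE \<odot>\<^sub>m Theta E) *\<^sub>v u + mat_adjoint (dF \<odot>\<^sub>m Theta F) *\<^sub>v p - dq)
          @\<^sub>v re_im ((dF \<odot>\<^sub>m Theta F) *\<^sub>v u + (dG \<odot>\<^sub>m Theta G) *\<^sub>v p - dr)"
proof -
  let ?N1 = "n * (n + 1) div 2" and ?N2 = "n * (n - 1) div 2"
  let ?s1 = "?N1 + (?N2 + (m * n + m * n))" and ?s2 = "m * n + (m * n + (m * m + m * m))"
  let ?s = "?N1 + (?N2 + (m * n + (m * n + (m * m + m * m))))"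
  let ?X1 = "X1_hat n \<alpha>1 \<alpha>2 E F u p" and ?X2 = "X2_hat m \<alpha>2 \<alpha>3 F G u p"
  let ?I1 = "- (inverse \<beta>1 \<cdot>\<^sub>m 1\<^sub>m (2 * n))" and ?I2 = "- (inverse \<beta>2 \<cdot>\<^sub>m 1\<^sub>m (2 * m))"
  let ?Z1 = "0\<^sub>m (2 * n) (2 * m\<^sup>2) :: real mat" and ?Z2 = "0\<^sub>m (2 * m) (n\<^sup>2) :: real mat"
  note X1 = X1_hat_carrier[OF E F u p, of \<alpha>1 \<alpha>2] and X2 = X2_hat_carrier[OF F G u p, of \<alpha>2 \<alpha>3]
  have Z1: "?Z1 \<in> carrier_mat (2 * n) (m * m + m * m)" and Z2: "?Z2 \<in> carrier_mat (2 * m) (?N1 + ?N2)"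
    unfolding triangle_numbers_add by (simp_all add: power2_eq_square flip: mult_2)
  have s: "?s1 + (m * m + m * m) = ?s" "(?N1 + ?N2) + ?s2 = ?s" by (simp_all only: add.assoc)
  have I: "?I1 \<in> carrier_mat (2 * n) (2 * n)" "?I2 \<in> carrier_mat (2 * m) (2 * m)" by simp_all
  have blocks: "?X1 @\<^sub>c ?Z1 \<in> carrier_mat (2 * n) ?s"
    "?I1 @\<^sub>c 0\<^sub>m (2 * n) (2 * m) \<in> carrier_mat (2 * n) (2 * n + 2 * m)"
    "?Z2 @\<^sub>c ?X2 \<in> carrier_mat (2 * m) ?s"
    "0\<^sub>m (2 * m) (2 * n) @\<^sub>c ?I2 \<in> carrier_mat (2 * m) (2 * n + 2 * m)"
    using append_cols_carrier[OF X1 Z1] append_cols_carrier[OF Z2 X2] I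
    by (simp_all only: s append_cols_carrier zero_carrier_mat)
  show "backward_mat n m \<alpha>1 \<alpha>2 \<alpha>3 \<beta>1 \<beta>2 E F G u p \<in> carrier_mat (2 * n + 2 * m) (coords_dim n m)"
    unfolding backward_mat_def coords_dim_def using blocks by (intro four_block_carrier_mat)
  assume pos: "\<alpha>1 > 0" "\<alpha>2 > 0" "\<alpha>3 > 0" "\<beta>1 > 0" "\<beta>2 > 0"
    and "(dE, dF, dG, dq, dr) \<in> herm_perts n m"
  then have dE: "dE \<in> carrier_mat n n" "hermitian_mat dE" and dF: "dF \<in> carrier_mat m n"
    and dG: "dG \<in> carrier_mat m m" and dq: "dq \<in> carrier_vec n" and dr: "dr \<in> carrier_vec m"
    by (simp_all add: herm_perts_def perts_def)
  define y1 y2 f1 f2 g1 g2 where y_def: "y1 = \<alpha>1 \<cdot>\<^sub>v (D_S n *\<^sub>v vecS (map_mat Re dE))"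
    "y2 = \<alpha>1 \<cdot>\<^sub>v (D_SK n *\<^sub>v vecSK (map_mat Im dE))"
    "f1 = \<alpha>2 \<cdot>\<^sub>v vec_mat (map_mat Re dF)" "f2 = \<alpha>2 \<cdot>\<^sub>v vec_mat (map_mat Im dF)"
    "g1 = \<alpha>3 \<cdot>\<^sub>v vec_mat (map_mat Re dG)" "g2 = \<alpha>3 \<cdot>\<^sub>v vec_mat (map_mat Im dG)"
  have y: "y1 \<in> carrier_vec ?N1" "y2 \<in> carrier_vec ?N2" "f1 \<in> carrier_vec (m * n)"
    "f2 \<in> carrier_vec (m * n)" "g1 \<in> carrier_vec (m * m)" "g2 \<in> carrier_vec (m * m)"
    unfolding y_def
    by (intro smult_carrier_vec[THEN iffD2] mult_mat_vec_carrier[OF D_S_carrier]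
        mult_mat_vec_carrier[OF D_SK_carrier] vecS_carrier vecSK_carrier vec_mat_carrier
        map_carrier_mat[THEN iffD2] dE dF dG)+
  let ?x = "y1 @\<^sub>v y2 @\<^sub>v f1 @\<^sub>v f2 @\<^sub>v g1 @\<^sub>v g2" and ?d = "\<beta>1 \<cdot>\<^sub>v re_im dq @\<^sub>v \<beta>2 \<cdot>\<^sub>v re_im dr"
  have x: "?x \<in> carrier_vec ?s" using y by (intro append_carrier_vec)
  have d: "\<beta>1 \<cdot>\<^sub>v re_im dq \<in> carrier_vec (2 * n)" "\<beta>2 \<cdot>\<^sub>v re_im dr \<in> carrier_vec (2 * m)"
    "?d \<in> carrier_vec (2 * n + 2 * m)"
    using dq dr by (simp_all add: append_carrier_vec)
  let ?w1 = "(dE \<odot>\<^sub>m Theta E) *\<^sub>v u + mat_adjoint (dF \<odot>\<^sub>m Theta F) *\<^sub>v p"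
  let ?w2 = "(dF \<odot>\<^sub>m Theta F) *\<^sub>v u + (dG \<odot>\<^sub>m Theta G) *\<^sub>v p"
  have w: "?w1 \<in> carrier_vec n" "?w2 \<in> carrier_vec m"
    using dE dF dG by (auto intro!: carrier_vecI)
  have zero: "0\<^sub>m k l *\<^sub>v v = 0\<^sub>v k" if "v \<in> carrier_vec l" for k l and v :: "real vec"
    using that by (intro eq_vecI) auto
  \<comment> \<open>The coordinates are ordered \<open>dE\<close>, \<open>dF\<close>,
    \<open>dG\<close>. Regrouping separates the tail \<open>dG\<close>, absent from the first
    equation; below, the head \<open>dE\<close> is separated for the second.\<close>
  have "(?X1 @\<^sub>c ?Z1) *\<^sub>v ?x = (?X1 @\<^sub>c ?Z1) *\<^sub>v ((y1 @\<^sub>v y2 @\<^sub>v f1 @\<^sub>v f2) @\<^sub>v (g1 @\<^sub>v g2))"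
    by (simp only: append_vec_assoc)
  also have "\<dots> = ?X1 *\<^sub>v (y1 @\<^sub>v y2 @\<^sub>v f1 @\<^sub>v f2) + ?Z1 *\<^sub>v (g1 @\<^sub>v g2)"
    by (rule append_cols_mult_vec[OF X1 Z1]) (intro append_carrier_vec y)+
  also have "?X1 *\<^sub>v (y1 @\<^sub>v y2 @\<^sub>v f1 @\<^sub>v f2) = re_im ?w1"
    unfolding y_def by (rule X1_hat_mult_vec[OF E F u p dE dF pos(1,2)])
  also have "?Z1 *\<^sub>v (g1 @\<^sub>v g2) = 0\<^sub>v (2 * n)"
    using zero[OF append_carrier_vec[OF y(5,6)]] by (simp add: power2_eq_square flip: mult_2)
  finally have 1: "(?X1 @\<^sub>c ?Z1) *\<^sub>v ?x = re_im ?w1" using w by simp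
  have "(?Z2 @\<^sub>c ?X2) *\<^sub>v ?x = (?Z2 @\<^sub>c ?X2) *\<^sub>v ((y1 @\<^sub>v y2) @\<^sub>v (f1 @\<^sub>v f2 @\<^sub>v g1 @\<^sub>v g2))"
    by (simp only: append_vec_assoc)
  also have "\<dots> = ?Z2 *\<^sub>v (y1 @\<^sub>v y2) + ?X2 *\<^sub>v (f1 @\<^sub>v f2 @\<^sub>v g1 @\<^sub>v g2)"
    by (rule append_cols_mult_vec[OF Z2 X2]) (intro append_carrier_vec y)+
  also have "?X2 *\<^sub>v (f1 @\<^sub>v f2 @\<^sub>v g1 @\<^sub>v g2) = re_im ?w2"
    unfolding y_def by (rule X2_hat_mult_vec[OF F G u p dF dG pos(2,3)])
  also have "?Z2 *\<^sub>v (y1 @\<^sub>v y2) = 0\<^sub>v (2 * m)"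
    using zero[OF append_carrier_vec[OF y(1,2)]] unfolding triangle_numbers_add .
  finally have 2: "(?Z2 @\<^sub>c ?X2) *\<^sub>v ?x = re_im ?w2" using w by simp
  have 3: "(?I1 @\<^sub>c 0\<^sub>m (2 * n) (2 * m)) *\<^sub>v ?d = - re_im dq"
    using d dq pos by (subst append_cols_mult_vec[OF I(1) zero_carrier_mat])
      (simp_all add: zero inverse_smult_mult_vec[of _ "2 * n" "2 * n"])
  have 4: "(0\<^sub>m (2 * m) (2 * n) @\<^sub>c ?I2) *\<^sub>v ?d = - re_im dr"
    using d dr pos by (subst append_cols_mult_vec[OF zero_carrier_mat I(2)])
      (simp_all add: zero inverse_smult_mult_vec[of _ "2 * m" "2 * m"])
  have "backward_mat n m \<alpha>1 \<alpha>2 \<alpha>3 \<beta>1 \<beta>2 E F G u p *\<^sub>v (?x @\<^sub>v ?d)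
      = (re_im ?w1 + - re_im dq) @\<^sub>v (re_im ?w2 + - re_im dr)"
    unfolding backward_mat_def four_block_mat_mult_vec[OF blocks x d(3)] 1 2 3 4 ..
  also have "re_im ?w1 + - re_im dq = re_im (?w1 - dq)"
    using re_im_diff[OF w(1) dq] minus_add_uminus_vec[of "re_im ?w1" "2 * n" "re_im dq"] w dq by simp
  also have "re_im ?w2 + - re_im dr = re_im (?w2 - dr)"
    using re_im_diff[OF w(2) dr] minus_add_uminus_vec[of "re_im ?w2" "2 * m" "re_im dr"] w dr by simp
  finally show "backward_mat n m \<alpha>1 \<alpha>2 \<alpha>3 \<beta>1 \<beta>2 E F G u p *\<^sub>v coords n \<alpha>1 \<alpha>2 \<alpha>3 \<beta>1 \<beta>2 (dE, dF, dG, dq, dr)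
      = re_im (?w1 - dq) @\<^sub>v re_im (?w2 - dr)"
    by (simp only: coords.simps y_def)
qed

text \<open>Every \<open>v\<close> is an image \<open>M *\<^sub>v y\<close>, so pairing
  \<open>v\<close> with itself moves to the transpose applied to \<open>v\<close>, paired with
  \<open>y\<close>, which is zero by assumption.\<close>

lemma backward_mat_transpose_inj:
  assumes "E \<in> carrier_mat n n" "hermitian_mat E" "F \<in> carrier_mat m n" "G \<in> carrier_mat m m"
    and "u \<in> carrier_vec n" "p \<in> carrier_vec m"
    and pos: "\<alpha>1 > 0" "\<alpha>2 > 0" "\<alpha>3 > 0" "\<beta>1 > 0" "\<beta>2 > 0"
    and v: "v \<in> carrier_vec (2 * n + 2 * m)"
    and 0: "(backward_mat n m \<alpha>1 \<alpha>2 \<alpha>3 \<beta>1 \<beta>2 E F G u p)\<^sup>T *\<^sub>v v = 0\<^sub>v (coords_dim n m)"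
  shows "v = 0\<^sub>v (2 * n + 2 * m)"
proof -
  let ?M = "backward_mat n m \<alpha>1 \<alpha>2 \<alpha>3 \<beta>1 \<beta>2 E F G u p"
  note M = backward_mat_carrier[OF assms(1-6), of \<alpha>1 \<alpha>2 \<alpha>3 \<beta>1 \<beta>2]
  obtain v1 v2 where v12: "v1 \<in> carrier_vec (2 * n)" "v2 \<in> carrier_vec (2 * m)" "v = v1 @\<^sub>v v2"
    using append_vec_surj[OF v] .
  obtain a where a: "a \<in> carrier_vec n" "re_im a = v1" using re_im_surj[OF v12(1)] .
  obtain b where b: "b \<in> carrier_vec m" "re_im b = v2" using re_im_surj[OF v12(2)] .
  let ?dE = "0\<^sub>m n n" and ?dF = "0\<^sub>m m n" and ?dG = "0\<^sub>m m m"
  define w1 where "w1 = (?dE \<odot>\<^sub>m Theta E) *\<^sub>v u + mat_adjoint (?dF \<odot>\<^sub>m Theta F) *\<^sub>v p"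
  define w2 where "w2 = (?dF \<odot>\<^sub>m Theta F) *\<^sub>v u + (?dG \<odot>\<^sub>m Theta G) *\<^sub>v p"
  have w: "w1 \<in> carrier_vec n" "w2 \<in> carrier_vec m"
    by (auto simp: w1_def w2_def intro!: carrier_vecI)
  \<comment> \<open>Only the right-hand sides are perturbed. The image of this tuple has the parts
    \<open>w1 - (w1 - a)\<close> and \<open>w2 - (w2 - b)\<close>, where \<open>w1\<close> and
    \<open>w2\<close> cancel and leave the prescribed \<open>a\<close> and \<open>b\<close>.\<close>
  let ?t = "(?dE, ?dF, ?dG, w1 - a, w2 - b)"
  have t: "?t \<in> herm_perts n m"
    using w a b by (auto simp: herm_perts_def perts_def intro!: hermitian_matI)
  define y where "y = coords n \<alpha>1 \<alpha>2 \<alpha>3 \<beta>1 \<beta>2 ?t"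
  have y: "y \<in> carrier_vec (coords_dim n m)" unfolding y_def by (rule coords_carrier[OF t])
  have "?M *\<^sub>v y = re_im (w1 - (w1 - a)) @\<^sub>v re_im (w2 - (w2 - b))"
    unfolding y_def backward_mat_mult_coords[OF assms(1-6) pos t] by (simp only: w1_def w2_def)
  also have "w1 - (w1 - a) = a" using w a by (intro eq_vecI) auto
  also have "w2 - (w2 - b) = b" using w b by (intro eq_vecI) auto
  finally have "?M *\<^sub>v y = v" by (simp add: a b v12)
  then have "v \<bullet> v = (?M\<^sup>T *\<^sub>v v) \<bullet> y"
    using transpose_vec_mult_scalar[OF M y v] by simp
  then show ?thesis
    using 0 y v by (intro scalar_prod_self_eq_0) simp_all
qed

section \<open>The backward error\<close>

lemma hadamard_Theta_idem:
  fixes A :: "'a :: semiring_1 mat"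
  assumes "A \<in> carrier_mat k l" "X \<in> carrier_mat k l"
  shows "A \<odot>\<^sub>m Theta X \<odot>\<^sub>m Theta X = A \<odot>\<^sub>m Theta X"
  using assms by (intro eq_matI) auto

lemma frob_norm_hadamard_Theta_le:
  fixes A :: "'a :: real_normed_algebra_1 mat"
  assumes "A \<in> carrier_mat k l" "X \<in> carrier_mat k l"
  shows "frob_norm (A \<odot>\<^sub>m Theta X) \<le> frob_norm A"
  using assms unfolding frob_norm_def
  by (auto intro!: real_sqrt_le_mono sum_mono)

lemma zeta_mask_le:
  assumes "t \<in> perts n m" "E \<in> carrier_mat n n" "F \<in> carrier_mat m n" "G \<in> carrier_mat m m"
  shows "zeta \<alpha>1 \<alpha>2 \<alpha>3 \<beta>1 \<beta>2 (mask E F G t) \<le> zeta \<alpha>1 \<alpha>2 \<alpha>3 \<beta>1 \<beta>2 t"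
proof -
  obtain dE dF dG dq dr where t: "t = (dE, dF, dG, dq, dr)" by (cases t)
  have "dE \<in> carrier_mat n n" "dF \<in> carrier_mat m n" "dG \<in> carrier_mat m m"
    using assms(1) by (auto simp: t perts_def)
  with assms(2-4) show ?thesis
    unfolding t mask.simps zeta.simps
    by (intro real_sqrt_le_mono add_mono mult_left_mono power_mono frob_norm_hadamard_Theta_le) auto
qed

text \<open>Moving the unperturbed products to the right exposes the residuals there and leaves on
  the left the quantities computed by \<open>backward_mat\<close>. The Hermitian condition falls on
  the masked \<open>dE\<close>.\<close>

lemma mask_G1_iff:
  assumes E: "E \<in> carrier_mat n n" and F: "F \<in> carrier_mat m n" and G: "G \<in> carrier_mat m m"
    and q: "q \<in> carrier_vec n" and r: "r \<in> carrier_vec m"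
    and u: "u \<in> carrier_vec n" and p: "p \<in> carrier_vec m"
    and t: "(dE, dF, dG, dq, dr) \<in> perts n m"
  shows "mask E F G (dE, dF, dG, dq, dr) \<in> G1 E F G q r u p \<longleftrightarrow>
    hermitian_mat (dE \<odot>\<^sub>m Theta E) \<and>
    (dE \<odot>\<^sub>m Theta E) *\<^sub>v u + mat_adjoint (dF \<odot>\<^sub>m Theta F) *\<^sub>v p - dq = q - E *\<^sub>v u - mat_adjoint F *\<^sub>v p \<and>
    (dF \<odot>\<^sub>m Theta F) *\<^sub>v u + (dG \<odot>\<^sub>m Theta G) *\<^sub>v p - dr = r - F *\<^sub>v u - G *\<^sub>v p"
proof -
  define A B C where "A = dE \<odot>\<^sub>m Theta E" and "B = dF \<odot>\<^sub>m Theta F" and "C = dG \<odot>\<^sub>m Theta G"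
  have d: "dE \<in> carrier_mat n n" "dF \<in> carrier_mat m n" "dG \<in> carrier_mat m m"
    "dq \<in> carrier_vec n" "dr \<in> carrier_vec m"
    using t by (simp_all add: perts_def)
  then have A: "A \<in> carrier_mat n n" and B: "B \<in> carrier_mat m n" and C: "C \<in> carrier_mat m m"
    by (simp_all add: A_def B_def C_def)
  have adj: "mat_adjoint F \<in> carrier_mat n m" "mat_adjoint B \<in> carrier_mat n m"
    using F B by (auto intro!: carrier_matI)
  have adj_add: "mat_adjoint (F + B) = mat_adjoint F + mat_adjoint B"
    using F B by (intro eq_matI) auto
  have "saddle (E + A) (F + B) (G + C) *\<^sub>v (u @\<^sub>v p) =
      ((E + A) *\<^sub>v u + mat_adjoint (F + B) *\<^sub>v p) @\<^sub>v ((F + B) *\<^sub>v u + (G + C) *\<^sub>v p)"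
    unfolding saddle_def using E F G A B C u p adj adj_add
    by (intro four_block_mat_mult_vec[of _ n n _ m _ m]) auto
  also have "\<dots> = ((E *\<^sub>v u + A *\<^sub>v u) + (mat_adjoint F *\<^sub>v p + mat_adjoint B *\<^sub>v p))
      @\<^sub>v ((F *\<^sub>v u + B *\<^sub>v u) + (G *\<^sub>v p + C *\<^sub>v p))"
    unfolding adj_add using E F G A B C u p adj by (simp add: add_mult_distrib_mat_vec)
  finally have saddle: "saddle (E + A) (F + B) (G + C) *\<^sub>v (u @\<^sub>v p) = \<dots>" .
  \<comment> \<open>Here \<open>a\<close> and \<open>c\<close> are the unperturbed products,
    \<open>b\<close> and \<open>d\<close> the perturbing ones, and \<open>x + y\<close> is the
    perturbed right-hand side.\<close>
  have rearrange: "(a + b) + (c + d) = x + y \<longleftrightarrow> (b + d) - y = x - a - c"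
    if "a \<in> carrier_vec k" "b \<in> carrier_vec k" "c \<in> carrier_vec k" "d \<in> carrier_vec k"
      "x \<in> carrier_vec k" "y \<in> carrier_vec k" for a b c d x y :: "complex vec" and k
  proof -
    have "a $ i + (b $ i + (c $ i + d $ i)) = x $ i + y $ i \<longleftrightarrow>
        b $ i + d $ i - y $ i = x $ i - a $ i - c $ i" for i
      by (auto simp: algebra_simps)
    with that show ?thesis by (auto simp: vec_eq_iff)
  qed
  have v: "E *\<^sub>v u \<in> carrier_vec n" "A *\<^sub>v u \<in> carrier_vec n" "mat_adjoint F *\<^sub>v p \<in> carrier_vec n"
    "mat_adjoint B *\<^sub>v p \<in> carrier_vec n" "F *\<^sub>v u \<in> carrier_vec m" "B *\<^sub>v u \<in> carrier_vec m"
    "G *\<^sub>v p \<in> carrier_vec m" "C *\<^sub>v p \<in> carrier_vec m"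
    using E F G A B C adj u p by (auto intro!: mult_mat_vec_carrier)
  have "mask E F G (dE, dF, dG, dq, dr) \<in> G1 E F G q r u p \<longleftrightarrow> hermitian_mat A \<and>
      saddle (E + A) (F + B) (G + C) *\<^sub>v (u @\<^sub>v p) = (q + dq) @\<^sub>v (r + dr)"
    using A B C d q r by (auto simp: G1_def perts_def A_def B_def C_def)
  also have "saddle (E + A) (F + B) (G + C) *\<^sub>v (u @\<^sub>v p) = (q + dq) @\<^sub>v (r + dr) \<longleftrightarrow>
      (E *\<^sub>v u + A *\<^sub>v u) + (mat_adjoint F *\<^sub>v p + mat_adjoint B *\<^sub>v p) = q + dq \<and>
      (F *\<^sub>v u + B *\<^sub>v u) + (G *\<^sub>v p + C *\<^sub>v p) = r + dr"
    unfolding saddle using v q d by (intro append_vec_eq[of _ n]) auto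
  also have "\<dots> \<longleftrightarrow>
      A *\<^sub>v u + mat_adjoint B *\<^sub>v p - dq = q - E *\<^sub>v u - mat_adjoint F *\<^sub>v p \<and>
      B *\<^sub>v u + C *\<^sub>v p - dr = r - F *\<^sub>v u - G *\<^sub>v p"
    unfolding rearrange[OF v(1-4) q d(4)] rearrange[OF v(5-8) r d(5)] ..
  finally show ?thesis unfolding A_def B_def C_def .
qed

theorem theorem3p1:
  fixes n m :: nat
    and E F G :: "complex mat" and q r u p :: "complex vec"
    and \<alpha>1 \<alpha>2 \<alpha>3 \<beta>1 \<beta>2 :: real
  assumes "E \<in> carrier_mat n n" and "hermitian_mat E"
    and "F \<in> carrier_mat m n" and "G \<in> carrier_mat m m"
    and "q \<in> carrier_vec n" and "r \<in> carrier_vec m"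
    and "invertible_mat (saddle E F G)"
    and "\<alpha>1 > 0" and "\<alpha>2 > 0" and "\<alpha>3 > 0" and "\<beta>1 > 0" and "\<beta>2 > 0"
    and "u \<in> carrier_vec n" and "p \<in> carrier_vec m"
  shows
    "let Q = q - E *\<^sub>v u - mat_adjoint F *\<^sub>v p;
         R = r - F *\<^sub>v u - G *\<^sub>v p;
         I1 = (- (inverse \<beta>1 \<cdot>\<^sub>m 1\<^sub>m (2 * n))) @\<^sub>c 0\<^sub>m (2 * n) (2 * m);
         I2 = 0\<^sub>m (2 * m) (2 * n) @\<^sub>c (- (inverse \<beta>2 \<cdot>\<^sub>m 1\<^sub>m (2 * m)));
         X1 = X1_hat n \<alpha>1 \<alpha>2 E F u p @\<^sub>c 0\<^sub>m (2 * n) (2 * m\<^sup>2);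
         X2 = 0\<^sub>m (2 * m) (n\<^sup>2) @\<^sub>c X2_hat m \<alpha>2 \<alpha>3 F G u p;
         M = four_block_mat X1 I1 X2 I2;
         b = map_vec Re Q @\<^sub>v map_vec Im Q @\<^sub>v map_vec Re R @\<^sub>v map_vec Im R
     in (\<exists>x \<in> sps_values \<alpha>1 \<alpha>2 \<alpha>3 \<beta>1 \<beta>2 E F G q r u p.
           \<forall>y \<in> sps_values \<alpha>1 \<alpha>2 \<alpha>3 \<beta>1 \<beta>2 E F G q r u p. x \<le> y) \<and>
        invertible_mat (M * M\<^sup>T) \<and>
        xi_sps \<alpha>1 \<alpha>2 \<alpha>3 \<beta>1 \<beta>2 E F G q r u p = vec_norm2 (M\<^sup>T * mat_inv (M * M\<^sup>T) *\<^sub>v b)"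
proof -
  note E = assms(1,2) and F = assms(3) and G = assms(4) and q = assms(5) and r = assms(6)
    and pos = assms(8-12) and u = assms(13) and p = assms(14)
  define Q where "Q = q - E *\<^sub>v u - mat_adjoint F *\<^sub>v p"
  define R where "R = r - F *\<^sub>v u - G *\<^sub>v p"
  define M where "M = backward_mat n m \<alpha>1 \<alpha>2 \<alpha>3 \<beta>1 \<beta>2 E F G u p"
  define b where "b = re_im Q @\<^sub>v re_im R"
  let ?vals = "sps_values \<alpha>1 \<alpha>2 \<alpha>3 \<beta>1 \<beta>2 E F G q r u p"
  let ?z = "zeta \<alpha>1 \<alpha>2 \<alpha>3 \<beta>1 \<beta>2" and ?c = "coords n \<alpha>1 \<alpha>2 \<alpha>3 \<beta>1 \<beta>2"
  have QR: "Q \<in> carrier_vec n" "R \<in> carrier_vec m"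
    using E F G q r by (auto simp: Q_def R_def intro!: carrier_vecI)
  have M: "M \<in> carrier_mat (2 * n + 2 * m) (coords_dim n m)"
    unfolding M_def by (rule backward_mat_carrier[OF E F G u p])
  have b: "b \<in> carrier_vec (2 * n + 2 * m)"
    using QR unfolding b_def by (intro append_carrier_vec re_im_carrier)
  have inj: "v = 0\<^sub>v (2 * n + 2 * m)"
    if "v \<in> carrier_vec (2 * n + 2 * m)" "M\<^sup>T *\<^sub>v v = 0\<^sub>v (coords_dim n m)" for v
    using backward_mat_transpose_inj[OF E F G u p pos that[unfolded M_def]] .
  define y where "y = M\<^sup>T * mat_inv (M * M\<^sup>T) *\<^sub>v b"
  have y: "y \<in> carrier_vec (coords_dim n m)" "M *\<^sub>v y = b"
    and least: "\<And>z. z \<in> carrier_vec (coords_dim n m) \<Longrightarrow> M *\<^sub>v z = b \<Longrightarrow> vec_norm2 y \<le> vec_norm2 z"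
    unfolding y_def using least_norm_carrier[OF M b inj] least_norm_solves[OF M b inj]
      least_norm_least[OF M b inj] by blast+
  have solves_iff: "M *\<^sub>v ?c (dE, dF, dG, dq, dr) = b \<longleftrightarrow>
      (dE \<odot>\<^sub>m Theta E) *\<^sub>v u + mat_adjoint (dF \<odot>\<^sub>m Theta F) *\<^sub>v p - dq = Q \<and>
      (dF \<odot>\<^sub>m Theta F) *\<^sub>v u + (dG \<odot>\<^sub>m Theta G) *\<^sub>v p - dr = R"
    if "(dE, dF, dG, dq, dr) \<in> herm_perts n m" for dE dF dG dq dr
  proof -
    let ?a = "(dE \<odot>\<^sub>m Theta E) *\<^sub>v u + mat_adjoint (dF \<odot>\<^sub>m Theta F) *\<^sub>v p - dq"
    let ?b = "(dF \<odot>\<^sub>m Theta F) *\<^sub>v u + (dG \<odot>\<^sub>m Theta G) *\<^sub>v p - dr"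
    have c: "?a \<in> carrier_vec n" "?b \<in> carrier_vec m"
      using that by (auto simp: herm_perts_def perts_def intro!: carrier_vecI)
    show ?thesis
      unfolding M_def b_def backward_mat_mult_coords[OF E F G u p pos that]
        append_vec_eq[OF re_im_carrier[OF c(1)] re_im_carrier[OF QR(1)]]
        re_im_inject[OF c(1) QR(1)] re_im_inject[OF c(2) QR(2)] ..
  qed
  have lower: "vec_norm2 y \<le> x" if "x \<in> ?vals" for x
  proof -
    from that obtain dE dF dG dq dr where t: "(dE, dF, dG, dq, dr) \<in> perts n m"
      "mask E F G (dE, dF, dG, dq, dr) \<in> G1 E F G q r u p" "x = ?z (mask E F G (dE, dF, dG, dq, dr))"
      using q r by (auto simp: sps_values_def)
    let ?t = "mask E F G (dE, dF, dG, dq, dr)"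
    have d: "dE \<in> carrier_mat n n" "dF \<in> carrier_mat m n" "dG \<in> carrier_mat m m"
      using t(1) by (simp_all add: perts_def)
    have eqs: "hermitian_mat (dE \<odot>\<^sub>m Theta E)"
      "(dE \<odot>\<^sub>m Theta E) *\<^sub>v u + mat_adjoint (dF \<odot>\<^sub>m Theta F) *\<^sub>v p - dq = Q"
      "(dF \<odot>\<^sub>m Theta F) *\<^sub>v u + (dG \<odot>\<^sub>m Theta G) *\<^sub>v p - dr = R"
      using t(2) unfolding mask_G1_iff[OF E(1) F G q r u p t(1)] Q_def R_def by blast+
    \<comment> \<open>The original \<open>dE\<close> may fail to be Hermitian off the pattern; the
      masked tuple is the one with faithful coordinates.\<close>
    have ht: "?t \<in> herm_perts n m"
      using t(1) eqs(1) by (simp add: herm_perts_def perts_def)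
    \<comment> \<open>Since \<open>M\<close> masks once more, idempotence of the mask identifies its
      image with the equations already known.\<close>
    have "M *\<^sub>v ?c ?t = b"
      using ht eqs unfolding mask.simps by (subst solves_iff)
        (simp_all add: hadamard_Theta_idem[OF d(1) E(1)] hadamard_Theta_idem[OF d(2) F]
          hadamard_Theta_idem[OF d(3) G])
    from least[OF coords_carrier[OF ht] this] show ?thesis
      by (simp only: zeta_coords[OF ht] t(3))
  qed
  have attained: "vec_norm2 y \<in> ?vals"
  proof -
    obtain t where t: "t \<in> herm_perts n m" "?c t = y"
      using coords_surj[OF y(1) pos] .
    obtain dE dF dG dq dr where t_eq: "t = (dE, dF, dG, dq, dr)" by (cases t)
    have perts: "(dE, dF, dG, dq, dr) \<in> perts n m" and herm: "hermitian_mat dE" "dE \<in> carrier_mat n n"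
      using t(1) by (auto simp: t_eq herm_perts_def perts_def)
    \<comment> \<open>The shortest solution yields a tuple \<open>t\<close> that need not respect
      the pattern; its mask satisfies the same equations and is therefore feasible.\<close>
    have "mask E F G t \<in> G1 E F G q r u p"
      using solves_iff[OF t(1)[unfolded t_eq]] t(2) y(2)
        hermitian_hadamard_Theta[OF herm(1) E(2) herm(2) E(1)]
      unfolding t_eq mask_G1_iff[OF E(1) F G q r u p perts] Q_def R_def by simp
    then have val: "?z (mask E F G t) \<in> ?vals"
      unfolding sps_values_def using perts q r by (intro CollectI exI[of _ t]) (simp add: t_eq)
    \<comment> \<open>Masking cannot increase the norm, while the lower bound holds for this
      feasible value; so the two numbers coincide.\<close>
    moreover have "?z (mask E F G t) \<le> vec_norm2 y"
      using zeta_mask_le[OF perts E(1) F G] zeta_coords[OF t(1)] t(2) unfolding t_eq by metis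
    ultimately show ?thesis using lower[OF val] by simp
  qed
  have "xi_sps \<alpha>1 \<alpha>2 \<alpha>3 \<beta>1 \<beta>2 E F G q r u p = vec_norm2 y"
    unfolding xi_sps_def by (intro Least_equality attained lower)
  moreover have "\<exists>x \<in> ?vals. \<forall>y \<in> ?vals. x \<le> y"
    using attained lower by blast
  moreover have "invertible_mat (M * M\<^sup>T)"
    by (rule invertible_gram[OF M b inj])
  ultimately show ?thesis
    unfolding Let_def y_def M_def b_def Q_def R_def backward_mat_def re_im_def append_vec_assoc
    by blast
qed

end
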